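(* One has $$V^0=\phi'_{[n]}(H^0)\qquad\text{and}\qquad W^k=\phi'_{[n]}(H^k)\ \text{ for all }k\in\{2,\dots,n\}.$$ In addition, $\phi'_{[n]}$ establishes an isomorphism of representations of $\mathfrak S_n$ between $\mathbb H_n$ and $L(\mathfrak S_n)$, so that $$V^0\cong S^{(n)}\qquad\text{and}\qquad W^k\cong H^k\ \text{ for all }k\in\{2,\dots,n\}$$ as representations of $\mathfrak S_n$, where $S^{(n)}$ is the trivial representation.
   Context: Let $n\ge 2$ and $[n]=\{1,\dots,n\}$. For a finite set $E$: $\mathcal P(E)=\{A\subset E: |A|\ge 2\}$, $\bar{\mathcal P}(E)=\mathcal P(E)\cup\{\emptyset\}$, $L(E)$ is the space of functions $E\to\mathbb R$ with its canonical inner product, $\delta_x$ is the Dirac function at $x$, $\mathbf 1_S$ the indicator of $S$. An injective word on $[n]$ is a finite sequence $\pi=\pi_1\cdots\pi_k$ of distinct elements of $[n]$; its content is $c(\pi)=\{\pi_1,\dots,\pi_k\}$ and its length $|\pi|=k$. The empty word is $\bar 0$. $\Gamma(A)$ is the set of injective words with content $A$ (so $\Gamma(\emptyset)=\{\bar 0\}$), $\Gamma_n=\bigsqcup_{A\in\mathcal P([n])}\Gamma(A)$, $\bar\Gamma_n=\Gamma_n\cup\{\bar 0\}$, and $\Gamma^k$ is the set of injective words on $[n]$ of length $k$. Each $L(\Gamma(A))$ is embedded in $L(\bar\Gamma_n)$ by extension by zero. $\pi\subset\sigma$ means that $\pi$ is a (not necessarily contiguous) subword of $\sigma$. Marginal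 operators: for $A\in\mathcal P([n])$, $M_AF(\pi)=\sum_{\sigma\in\Gamma_n,\,\pi\subset\sigma}F(\sigma)$ for $\pi\in\Gamma(A)$; $M_\emptyset F=\big(\sum_{\pi\in\bar\Gamma_n}F(\pi)\big)\delta_{\bar 0}$; $M_A=M_\emptyset$ if $|A|=1$. Spaces: $H_\emptyset=\mathbb R\delta_{\bar 0}$; for $B\in\mathcal P([n])$, $H_B=\{F\in L(\Gamma(B)): M_{B'}F=0\text{ for all }B'\subsetneq B\}$; $H^k=\bigoplus_{|B|=k}H_B$ for $k\in\{0,2,\dots,n\}$; $\mathbb H_n=\bigoplus_{B\in\bar{\mathcal P}([n])}H_B$. Permutations: $\mathfrak S_n$ is identified with $\Gamma([n])$ (the word $\pi_1\cdots\pi_n$ corresponds to the permutation mapping $\pi_i$ to $i$). For $\pi\in\bar\Gamma_n$, $\mathfrak S_n(\pi)=\{\sigma\in\mathfrak S_n:\pi\subset\sigma\}$ (so $\mathfrak S_n(\bar 0)=\mathfrak S_n$). Define $\phi'_{[n]}:L(\bar\Gamma_n)\to L(\mathfrak S_n)$, $\phi'_{[n]}f=\sum_{\pi\in\bar\Gamma_n}\frac{|\pi|!}{n!}f(\pi)\mathbf 1_{\mathfrak S_n(\pi)}$. $V^0=\mathbb R\mathbf 1_{\mathfrak S_n}$, and for $k\in\{2,\dots,n\}$, $V^k=\phi'_{[n]}(L(\Gamma^k))=\operatorname{span}\{\mathbf 1_{\mathfrak S_n(\pi)}:\pi\in\Gamma^k\}$. One has $V^0\subset V^2\subset\dots\subset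 V^n=L(\mathfrak S_n)$. $W^2$ is the orthogonal complement of $V^0$ in $V^2$, and for $k\in\{3,\dots,n\}$, $W^k$ is the orthogonal complement of $V^{k-1}$ in $V^k$. Action: $\tau\in\mathfrak S_n$ acts on $L(\bar\Gamma_n)$ by $T_\tau\delta_{\pi_1\cdots\pi_k}=\delta_{\tau(\pi_1)\cdots\tau(\pi_k)}$, $T_\tau\delta_{\bar 0}=\delta_{\bar 0}$; this restricts to representations on $H^k$, $\mathbb H_n$ and $L(\Gamma([n]))=L(\mathfrak S_n)$. *)

theory Defs
  imports
    "HOL-Algebra.Sym_Groups"
    "HOL-Library.Function_Algebras"
    "HOL-Library.Sublist"
    "HOL-Library.Indicator_Function"
begin

text \<open>
  Real-valued functions form a real vector space under the pointwise operations, so that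
  \<^const>\<open>subspace\<close> and \<^const>\<open>span\<close> apply to them.
\<close>

instantiation "fun" :: (type, real_vector) real_vector
begin

definition scaleR_fun :: "real \<Rightarrow> ('a \<Rightarrow> 'b) \<Rightarrow> 'a \<Rightarrow> 'b"
  where "scaleR_fun c f = (\<lambda>x. c *\<^sub>R f x)"

instance
  by standard (simp_all add: scaleR_fun_def fun_eq_iff scaleR_add_right scaleR_add_left)

end

text \<open>
  The space \<open>L(E)\<close> consists of the functions vanishing outside \<open>E\<close>; extension by zero
  from \<open>E\<close> to a larger set is then plain inclusion.
\<close>

definition fun_space :: "'a set \<Rightarrow> ('a \<Rightarrow> real) set"
  where "fun_space E = {f. \<forall>x. x \<notin> E \<longrightarrow> f x = 0}"

definition fun_inner :: "'a set \<Rightarrow> ('a \<Rightarrow> real) \<Rightarrow> ('a \<Rightarrow> real) \<Rightarrow> real"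
  where "fun_inner E f g = (\<Sum>x\<in>E. f x * g x)"

definition dirac :: "'a \<Rightarrow> 'a \<Rightarrow> real"
  where "dirac x = (\<lambda>y. if y = x then 1 else 0)"

definition sum_of_subspaces :: "'i set \<Rightarrow> ('i \<Rightarrow> 'v::real_vector set) \<Rightarrow> 'v set"
  where "sum_of_subspaces I U = {\<Sum>i\<in>I. u i | u. \<forall>i\<in>I. u i \<in> U i}"


subsection \<open>Linear representations\<close>

definition linear_between ::
    "'v::real_vector set \<Rightarrow> 'w::real_vector set \<Rightarrow> ('v \<Rightarrow> 'w) \<Rightarrow> bool"
  where "linear_between V W f \<longleftrightarrow>
    f ` V \<subseteq> W \<and>
    (\<forall>x\<in>V. \<forall>y\<in>V. f (x + y) = f x + f y) \<and>
    (\<forall>c. \<forall>x\<in>V. f (c *\<^sub>R x) = c *\<^sub>R f x)"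

definition linear_rep :: "('g, 'm) monoid_scheme \<Rightarrow> 'v::real_vector set \<Rightarrow> ('g \<Rightarrow> 'v \<Rightarrow> 'v) \<Rightarrow> bool"
  where "linear_rep G V \<rho> \<longleftrightarrow>
    Group.group G \<and> subspace V \<and>
    (\<forall>g\<in>carrier G. linear_between V V (\<rho> g)) \<and>
    (\<forall>x\<in>V. \<rho> \<one>\<^bsub>G\<^esub> x = x) \<and>
    (\<forall>g\<in>carrier G. \<forall>h\<in>carrier G. \<forall>x\<in>V. \<rho> (g \<otimes>\<^bsub>G\<^esub> h) x = \<rho> g (\<rho> h x))"

definition rep_iso ::
    "('g, 'm) monoid_scheme \<Rightarrow> 'v::real_vector set \<Rightarrow> ('g \<Rightarrow> 'v \<Rightarrow> 'v) \<Rightarrow>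
      'w::real_vector set \<Rightarrow> ('g \<Rightarrow> 'w \<Rightarrow> 'w) \<Rightarrow> ('v \<Rightarrow> 'w) \<Rightarrow> bool"
  where "rep_iso G V \<rho> W \<rho>' f \<longleftrightarrow>
    linear_rep G V \<rho> \<and> linear_rep G W \<rho>' \<and>
    linear_between V W f \<and> bij_betw f V W \<and>
    (\<forall>g\<in>carrier G. \<forall>x\<in>V. f (\<rho> g x) = \<rho>' g (f x))"

definition rep_isomorphic ::
    "('g, 'm) monoid_scheme \<Rightarrow> 'v::real_vector set \<Rightarrow> ('g \<Rightarrow> 'v \<Rightarrow> 'v) \<Rightarrow>
      'w::real_vector set \<Rightarrow> ('g \<Rightarrow> 'w \<Rightarrow> 'w) \<Rightarrow> bool"
  where "rep_isomorphic G V \<rho> W \<rho>' \<longleftrightarrow> (\<exists>f. rep_iso G V \<rho> W \<rho>' f)"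


subsection \<open>Injective words\<close>

definition big_subsets :: "'a set \<Rightarrow> 'a set set"
  where "big_subsets E = {A. A \<subseteq> E \<and> 2 \<le> card A}"

definition big_subsets0 :: "'a set \<Rightarrow> 'a set set"
  where "big_subsets0 E = big_subsets E \<union> {{}}"

definition words_on :: "nat set \<Rightarrow> nat list set"
  where "words_on A = {w. distinct w \<and> set w = A}"

definition words :: "nat \<Rightarrow> nat list set"
  where "words n = (\<Union>A\<in>big_subsets {1..n}. words_on A)"

definition words0 :: "nat \<Rightarrow> nat list set"
  where "words0 n = words n \<union> {[]}"

definition words_of_length :: "nat \<Rightarrow> nat \<Rightarrow> nat list set"
  where "words_of_length n k = {w. distinct w \<and> set w \<subseteq> {1..n} \<and> length w = k}"

text \<open>
  As a set, \<open>S\<^sub>n\<close> is identified with the full words: \<open>\<pi>\<^sub>1 \<dots> \<pi>\<^sub>n\<close> stands for the permutation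
  sending \<open>\<pi>\<^sub>i\<close> to \<open>i\<close>. The acting group is \<^const>\<open>sym_group\<close>, whose elements are genuine
  permutations of \<open>{1..n}\<close>.
\<close>

definition full_words :: "nat \<Rightarrow> nat list set"
  where "full_words n = words_on {1..n}"

definition full_words_over :: "nat \<Rightarrow> nat list \<Rightarrow> nat list set"
  where "full_words_over n \<pi> = {\<sigma> \<in> full_words n. subseq \<pi> \<sigma>}"


subsection \<open>Marginal operators and the spaces they define\<close>

definition marginal :: "nat \<Rightarrow> nat set \<Rightarrow> (nat list \<Rightarrow> real) \<Rightarrow> nat list \<Rightarrow> real"
  where "marginal n A F =
    (if card A \<le> 1 then (\<Sum>\<pi>\<in>words0 n. F \<pi>) *\<^sub>R dirac []
     else (\<lambda>\<pi>. if \<pi> \<in> words_on A then \<Sum>\<sigma>\<in>{\<sigma> \<in> words n. subseq \<pi> \<sigma>}. F \<sigma> else 0))"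

definition H_set :: "nat \<Rightarrow> nat set \<Rightarrow> (nat list \<Rightarrow> real) set"
  where "H_set n B =
    (if B = {} then span {dirac []}
     else {F \<in> fun_space (words_on B). \<forall>B'. B' \<subset> B \<longrightarrow> marginal n B' F = 0})"

definition H_level :: "nat \<Rightarrow> nat \<Rightarrow> (nat list \<Rightarrow> real) set"
  where "H_level n k = sum_of_subspaces {B \<in> big_subsets0 {1..n}. card B = k} (H_set n)"

definition H_total :: "nat \<Rightarrow> (nat list \<Rightarrow> real) set"
  where "H_total n = sum_of_subspaces (big_subsets0 {1..n}) (H_set n)"

lemma sum_fun_eval: "(\<Sum>i\<in>I. f i) x = (\<Sum>i\<in>I. f i x)"
  for f :: "'i \<Rightarrow> 'a \<Rightarrow> 'b::comm_monoid_add"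
  by (induction I rule: infinite_finite_induct) auto

lemma H_set_support:
  assumes "F \<in> H_set n B"
  shows "F \<in> fun_space (words_on B)"
proof (cases "B = {}")
  case True
  with assms obtain c where "F = c *\<^sub>R dirac []"
    by (auto simp: H_set_def span_singleton)
  then show ?thesis
    using True by (auto simp: fun_space_def words_on_def dirac_def scaleR_fun_def)
next
  case False
  then show ?thesis
    using assms by (simp add: H_set_def)
qed

text \<open>The sums defining \<^const>\<open>H_level\<close> and \<^const>\<open>H_total\<close> are direct.\<close>

lemma H_set_independent:
  assumes "finite I" and "\<And>B. B \<in> I \<Longrightarrow> F B \<in> H_set n B"
    and "(\<Sum>B\<in>I. F B) = 0" and "B \<in> I"
  shows "F B = 0"
proof
  fix w
  show "F B w = 0 w"
  proof (cases "w \<in> words_on B")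
    case True
    have "F C w = 0" if "C \<in> I - {B}" for C
      using H_set_support[of "F C" n C] assms(2)[of C] that True
      by (auto simp: fun_space_def words_on_def)
    then have "(\<Sum>C\<in>I. F C w) = F B w"
      using assms(1,4) by (simp add: sum.remove)
    then show ?thesis
      using assms(3) by (metis sum_fun_eval zero_fun_apply)
  next
    case False
    then show ?thesis
      using H_set_support[OF assms(2)[OF assms(4)]] by (simp add: fun_space_def)
  qed
qed


subsection \<open>The embedding into functions on permutations\<close>

definition phi :: "nat \<Rightarrow> (nat list \<Rightarrow> real) \<Rightarrow> nat list \<Rightarrow> real"
  where "phi n f =
    (\<Sum>\<pi>\<in>words0 n. (fact (length \<pi>) / fact n * f \<pi>) *\<^sub>R indicator (full_words_over n \<pi>))"

text \<open>Only \<open>k = 0\<close> and \<open>2 \<le> k \<le> n\<close> are meaningful below.\<close>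

definition V_space :: "nat \<Rightarrow> nat \<Rightarrow> (nat list \<Rightarrow> real) set"
  where "V_space n k =
    (if k = 0 then span {indicator (full_words n)}
     else phi n ` fun_space (words_of_length n k))"

text \<open>There is no space at level \<open>1\<close>: the predecessor of level \<open>2\<close> is level \<open>0\<close>.\<close>

definition W_space :: "nat \<Rightarrow> nat \<Rightarrow> (nat list \<Rightarrow> real) set"
  where "W_space n k =
    {f \<in> V_space n k.
      \<forall>g \<in> V_space n (if k = 2 then 0 else k - 1). fun_inner (full_words n) f g = 0}"

text \<open>The linear extension of \<open>\<delta>\<^sub>\<pi> \<mapsto> \<delta>\<^bsub>\<tau>(\<pi>)\<^esub>\<close>, with \<open>\<tau>\<close> applied to the letters.\<close>

definition act :: "nat \<Rightarrow> (nat \<Rightarrow> nat) \<Rightarrow> (nat list \<Rightarrow> real) \<Rightarrow> nat list \<Rightarrow> real"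
  where "act n \<tau> F = (\<Sum>\<pi>\<in>words0 n. F \<pi> *\<^sub>R dirac (map \<tau> \<pi>))"

definition trivial_act :: "(nat \<Rightarrow> nat) \<Rightarrow> real \<Rightarrow> real"
  where "trivial_act \<tau> x = x"

end

theory Submission
  imports Defs
begin

text \<open>
  On a full word \<open>\<sigma>\<close> the function \<open>\<phi>'f\<close> is the sum of the weighted values of \<open>f\<close> over all subwords
  of \<open>\<sigma>\<close> (lemma \<open>phi_eq_subword_sum\<close>), and the spaces \<open>H\<^sub>B\<close> are described by one-letter
  conditions: a function \<open>f\<close> living on injective words of length other than one belongs to their
  sum exactly when, for every injective word \<open>w\<close> and every letter \<open>x\<close> outside \<open>w\<close>, the sum \<open>D\<^sub>x f
  w\<close> of \<open>f\<close> over all insertions of \<open>x\<close> into \<open>w\<close> vanishes. Such functions are called harmonic below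
  (lemma \<open>H_total_eq\<close>), because a marginal is obtained by deleting letters one at a time.

  Everything rests on what \<open>D\<^sub>x\<close> does to a sum over subwords. If \<open>L\<close> denotes the sum over subwords
  and \<open>S\<^sub>x f v\<close> is the sum of \<open>f\<close> over the words obtained from \<open>v\<close> by replacing one letter with
  \<open>x\<close>, then \<open>D\<^sub>x L f w = (|w| + 1) L f w + L (D\<^sub>x f) w + L (S\<^sub>x f) w\<close> and \<open>D\<^sub>y S\<^sub>x = S\<^sub>x D\<^sub>y +
  D\<^sub>x\<close>; both are inductions on lists. Consequently, for \<open>f\<close> harmonic over an alphabet \<open>A\<close>, one has
  \<open>D\<^sub>x L f = L g\<close> on the words with content \<open>A - {x}\<close>, where \<open>g = |A| f + S\<^sub>x f\<close> is harmonic over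
  \<open>A - {x}\<close> and lives on the same word lengths as \<open>f\<close>.

  This has two consequences. Orthogonality (\<open>sum_superwords_subword_sum_eq_0\<close>): summing \<open>L f\<close> over
  all superwords of \<open>\<rho>\<close> amounts to removing the letters outside \<open>\<rho>\<close> one by one, which ends with \<open>L
  h \<rho>\<close> for some \<open>h\<close> living on words of the same length as \<open>f\<close>; this is zero if that length exceeds
  \<open>|\<rho>|\<close>. Hence \<open>\<phi>'(H\<^sup>k)\<close> is orthogonal to \<open>V\<^bsup>k-1\<^esup>\<close>, where \<open>V\<^sup>1\<close> stands for \<open>V\<^sup>0\<close>. Injectivity
  (\<open>subword_sum_inj\<close>): if \<open>L f\<close> vanishes on the words with content \<open>A\<close>, then by induction on \<open>|A|\<close>
  one gets \<open>|A| f v = - S\<^sub>x f v\<close> whenever \<open>v\<close> avoids \<open>x\<close>; as \<open>S\<^sub>x f v\<close> has only \<open>|v| < |A|\<close> terms,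
  choosing \<open>v\<close> with \<open>|f v|\<close> maximal shows that \<open>f\<close> vanishes on the words that do not use all of
  \<open>A\<close>, and on the remaining ones \<open>f = L f\<close>.

  For the remaining inclusion, \<open>H\<^sup>k\<close> is the orthogonal complement in \<open>L(\<Gamma>\<^sup>k)\<close> of the indicators of
  the sets of insertions of \<open>x\<close> into \<open>w\<close> with \<open>|w| = k - 1\<close>. The operator \<open>\<phi>'\<close> maps such an
  indicator to a multiple of the indicator of the permutations containing \<open>w\<close>, which lies in
  \<open>V\<^bsup>k-1\<^esup>\<close>. So \<open>V\<^sup>k = \<phi>'(H\<^sup>k) + V\<^bsup>k-1\<^esup>\<close> (\<open>phi_decomposition\<close>), and with orthogonality \<open>W\<^sup>k =
  \<phi>'(H\<^sup>k)\<close>. The same decomposition, iterated down from \<open>V\<^sup>n = L(S\<^sub>n)\<close>, shows that \<open>\<phi>'\<close> is onto.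
  Equivariance holds because the notions of subword and of insertion do not depend on the names of
  the letters.
\<close>

section \<open>Sums over subwords, insertions and replacements\<close>

definition subword_sum :: "('a list \<Rightarrow> real) \<Rightarrow> 'a list \<Rightarrow> real"
  where "subword_sum f w = (\<Sum>v\<leftarrow>subseqs w. f v)"

fun insertion_sum :: "'a \<Rightarrow> ('a list \<Rightarrow> real) \<Rightarrow> 'a list \<Rightarrow> real" where
  "insertion_sum x f [] = f [x]"
| "insertion_sum x f (a # w) = f (x # a # w) + insertion_sum x (\<lambda>v. f (a # v)) w"

fun replacement_sum :: "'a \<Rightarrow> ('a list \<Rightarrow> real) \<Rightarrow> 'a list \<Rightarrow> real" where
  "replacement_sum x f [] = 0"
| "replacement_sum x f (a # w) = f (x # w) + replacement_sum x (\<lambda>v. f (a # v)) w"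

lemma subword_sum_simps [simp]:
  "subword_sum f [] = f []"
  "subword_sum f (a # w) = subword_sum (\<lambda>v. f (a # v)) w + subword_sum f w"
  by (simp_all add: subword_sum_def Let_def comp_def)

lemma subword_sum_add: "subword_sum (\<lambda>v. f v + g v) w = subword_sum f w + subword_sum g w"
  by (simp add: subword_sum_def sum_list_addf)

lemma subword_sum_mult: "subword_sum (\<lambda>v. c * f v) w = c * subword_sum f w"
  by (simp add: subword_sum_def sum_list_const_mult)

lemma subword_sum_cong:
  assumes "\<And>v. subseq v w \<Longrightarrow> f v = g v"
  shows "subword_sum f w = subword_sum g w"
  using assms unfolding subword_sum_def by (intro arg_cong[where f = sum_list] map_cong) auto

lemma subword_sum_eq_0:
  assumes "\<And>v. subseq v w \<Longrightarrow> f v = 0"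
  shows "subword_sum f w = 0"
  using subword_sum_cong[of w f "\<lambda>_. 0"] assms by (simp add: subword_sum_def)

lemma distinct_subseq: "subseq v w \<Longrightarrow> distinct w \<Longrightarrow> distinct v"
  using subseqs_distinctD[of v w] by simp

lemma set_subseq: "subseq v w \<Longrightarrow> set v \<subseteq> set w"
  by (auto simp: subseq_conv_nths dest: in_set_nthsD)

lemma finite_subseqs: "finite {v. subseq v w}"
  by (metis set_subseqs_eq List.finite_set)

lemma subword_sum_eq_sum:
  assumes "distinct w"
  shows "subword_sum f w = (\<Sum>v | subseq v w. f v)"
proof -
  have "distinct (subseqs w)"
    using distinct_set_subseqs[OF assms] by (simp add: distinct_map)
  then show ?thesis
    by (simp add: subword_sum_def sum_list_distinct_conv_sum_set set_subseqs_eq)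
qed

lemma insertion_sum_add:
  "insertion_sum x (\<lambda>v. f v + g v) w = insertion_sum x f w + insertion_sum x g w"
  by (induction w arbitrary: f g) (simp_all add: algebra_simps)

lemma insertion_sum_mult: "insertion_sum x (\<lambda>v. c * f v) w = c * insertion_sum x f w"
  by (induction w arbitrary: f) (simp_all add: algebra_simps)

lemma replacement_sum_add:
  "replacement_sum x (\<lambda>v. f v + g v) w = replacement_sum x f w + replacement_sum x g w"
  by (induction w arbitrary: f g) (simp_all add: algebra_simps)

text \<open>
  A subword of an insertion of \<open>x\<close> into \<open>w\<close> either leaves the inserted letter out, and then it is a
  subword of \<open>w\<close> found for each of the \<open>|w| + 1\<close> positions, or it has the form \<open>\<alpha>x\<beta>\<close> with \<open>v = \<alpha>\<beta>\<close> a subword of \<open>w\<close>.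
  The number of positions that produce the latter is one, which accounts for the insertions into
  \<open>v\<close>, plus the number of letters of \<open>w\<close> between \<open>\<alpha>\<close> and \<open>\<beta>\<close>; each such letter \<open>y\<close> exhibits \<open>\<alpha>x\<beta>\<close> as a
  replacement in the subword \<open>\<alpha>y\<beta>\<close>.
\<close>

lemma insertion_sum_subword_sum:
  "insertion_sum x (subword_sum f) w =
    (real (length w) + 1) * subword_sum f w +
    subword_sum (insertion_sum x f) w + subword_sum (replacement_sum x f) w"
proof (induction w arbitrary: f)
  case Nil
  then show ?case by simp
next
  case (Cons a w)
  then show ?case
    by (simp add: insertion_sum_add subword_sum_add algebra_simps)
qed

text \<open>
  Inserting \<open>y\<close> and then replacing a letter by \<open>x\<close> commutes with doing so in the other order, unless
  the replaced letter is the inserted \<open>y\<close> itself: this leaves an insertion of \<open>x\<close>.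
\<close>

lemma insertion_sum_replacement_sum:
  "insertion_sum y (replacement_sum x f) w =
    replacement_sum x (insertion_sum y f) w + insertion_sum x f w"
  by (induction w arbitrary: f) (simp_all add: insertion_sum_add replacement_sum_add)

lemma replacement_sum_eq: "replacement_sum x f w = (\<Sum>j<length w. f (w[j := x]))"
  by (induction w arbitrary: f) (simp_all add: sum.lessThan_Suc_shift del: sum.lessThan_Suc)

text \<open>
  The insertions of \<open>x\<close> into a word that avoids \<open>x\<close> are described by deleting \<open>x\<close> again, which makes
  them the fibres of a map and lets sums over words be grouped by them.
\<close>

lemma insertion_sum_eq:
  assumes "x \<notin> set w"
  shows "finite {v. x \<in> set v \<and> remove1 x v = w} \<and>
    insertion_sum x f w = (\<Sum>v | x \<in> set v \<and> remove1 x v = w. f v)"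
  using assms
proof (induction w arbitrary: f)
  case Nil
  have "{v. x \<in> set v \<and> remove1 x v = []} = {[x]}"
  proof (intro Set.set_eqI iffI)
    fix v assume "v \<in> {v. x \<in> set v \<and> remove1 x v = []}"
    then show "v \<in> {[x]}"
      by (cases v) (auto split: if_splits)
  qed auto
  then show ?case by simp
next
  case (Cons a w)
  let ?S = "{v. x \<in> set v \<and> remove1 x v = w}"
  have eq: "{v. x \<in> set v \<and> remove1 x v = a # w} = insert (x # a # w) ((#) a ` ?S)"
  proof (intro Set.set_eqI iffI)
    fix v assume "v \<in> {v. x \<in> set v \<and> remove1 x v = a # w}"
    then show "v \<in> insert (x # a # w) ((#) a ` ?S)"
      by (cases v) (auto split: if_splits)
  qed (use Cons.prems in auto)
  have fin: "finite ?S" using Cons by simp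
  have "x # a # w \<notin> (#) a ` ?S" using Cons.prems by auto
  then show ?case
    using Cons fin unfolding eq by (simp add: sum.reindex)
qed

section \<open>Harmonic functions on injective words\<close>

text \<open>
  Restricted to the injective words over \<open>A\<close>, these are the linear functionals on the multilinear part
  of the shuffle algebra over \<open>A\<close> that vanish on the ideal generated by the letters.
\<close>

definition harmonic :: "'a set \<Rightarrow> ('a list \<Rightarrow> real) \<Rightarrow> bool"
  where "harmonic A f \<longleftrightarrow>
    (\<forall>x w. distinct (x # w) \<and> set (x # w) \<subseteq> A \<longrightarrow> insertion_sum x f w = 0)"

text \<open>
  A replacement by \<open>x\<close> in a word over \<open>A - {x}\<close> stays injective, so the commutation rule turns the
  insertion sums of \<open>S\<^sub>x f\<close> into insertion sums of \<open>f\<close> at injective words over \<open>A\<close>.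
\<close>

lemma harmonic_replacement:
  assumes "harmonic A f" "x \<in> A"
  shows "harmonic (A - {x}) (\<lambda>v. c * f v + replacement_sum x f v)"
  unfolding harmonic_def
proof (intro allI impI)
  fix y w assume y: "distinct (y # w) \<and> set (y # w) \<subseteq> A - {x}"
  have "insertion_sum y f (w[j := x]) = 0" if "j < length w" for j
  proof -
    have "set (w[j := x]) \<subseteq> insert x (set w)" by (rule set_update_subset_insert)
    moreover have "distinct (w[j := x])" using y by (intro distinct_list_update) auto
    ultimately have "distinct (y # w[j := x]) \<and> set (y # w[j := x]) \<subseteq> A"
      using assms(2) y by auto
    then show ?thesis
      using assms(1) unfolding harmonic_def by blast
  qed
  moreover have "insertion_sum x f w = 0" "insertion_sum y f w = 0"
    using assms y unfolding harmonic_def by auto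
  ultimately show "insertion_sum y (\<lambda>v. c * f v + replacement_sum x f v) w = 0"
    by (simp add: insertion_sum_add insertion_sum_mult insertion_sum_replacement_sum
        replacement_sum_eq[of x "insertion_sum y f"])
qed

lemma finite_words_on: "finite A \<Longrightarrow> finite (words_on A)"
  unfolding words_on_def
  by (rule finite_subset[OF _ finite_subset_distinct[of A]]) auto

text \<open>
  One letter is removed from the alphabet at the price of passing to another harmonic function;
  both the orthogonality and the injectivity below are inductions driven by this step.
\<close>

lemma harmonic_insertion_sum:
  assumes "harmonic A f" "finite A" "x \<in> A" "w \<in> words_on (A - {x})"
  shows "insertion_sum x (subword_sum f) w =
    subword_sum (\<lambda>v. real (card A) * f v + replacement_sum x f v) w"
proof -
  have w: "distinct w" "set w = A - {x}" using assms(4) by (auto simp: words_on_def)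
  then have "card A = length w + 1"
    using assms(2,3) by (metis Suc_eq_plus1 card_Suc_Diff1 distinct_card)
  moreover have "subword_sum (insertion_sum x f) w = 0"
  proof (rule subword_sum_eq_0)
    fix v assume "subseq v w"
    then have "distinct v" "set v \<subseteq> A - {x}"
      using w by (auto dest: distinct_subseq set_subseq)
    then show "insertion_sum x f v = 0"
      using assms(1,3) unfolding harmonic_def by (auto dest: subsetD)
  qed
  ultimately show ?thesis
    by (simp add: insertion_sum_subword_sum subword_sum_add subword_sum_mult)
qed

lemma subseq_remove1_iff:
  assumes "x \<notin> set r"
  shows "subseq r (remove1 x v) \<longleftrightarrow> subseq r v"
  using assms
proof (induction v arbitrary: r)
  case (Cons a v)
  then show ?case by (cases r) auto
qed simp

lemma words_on_remove1D:
  assumes "x \<in> set v" "x \<in> A" "remove1 x v \<in> words_on (A - {x})"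
  shows "v \<in> words_on A"
proof -
  obtain p q where "v = p @ x # q" "x \<notin> set p"
    using split_list_first[OF assms(1)] by blast
  then show ?thesis
    using assms(2,3) by (auto simp: words_on_def remove1_append)
qed

text \<open>
  Words with content \<open>A\<close> are grouped by what remains after deleting \<open>x\<close>; since \<open>r\<close> avoids \<open>x\<close>, the
  deletion does not affect whether \<open>r\<close> is a subword.
\<close>

lemma sum_superwords_remove:
  assumes "finite A" "x \<in> A" "x \<notin> set r"
  shows "(\<Sum>v | v \<in> words_on A \<and> subseq r v. f v) =
    (\<Sum>w | w \<in> words_on (A - {x}) \<and> subseq r w. insertion_sum x f w)"
proof -
  let ?V = "{v. v \<in> words_on A \<and> subseq r v}"
  let ?W = "{w. w \<in> words_on (A - {x}) \<and> subseq r w}"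
  have "(\<Sum>v\<in>?V. f v) = (\<Sum>w\<in>?W. \<Sum>v | v \<in> ?V \<and> remove1 x v = w. f v)"
    using assms by (intro sum.group[symmetric])
      (auto simp: words_on_def subseq_remove1_iff intro: finite_subset[OF _ finite_words_on[of A]]
         finite_subset[OF _ finite_words_on[of "A - {x}"]])
  also have "\<dots> = (\<Sum>w\<in>?W. insertion_sum x f w)"
  proof (rule sum.cong[OF refl])
    fix w assume w: "w \<in> ?W"
    have "v \<in> ?V" if "x \<in> set v" "remove1 x v = w" for v
      using that w assms(2) subseq_remove1_iff[OF assms(3), of v] by (auto intro: words_on_remove1D)
    then have "{v. v \<in> ?V \<and> remove1 x v = w} = {v. x \<in> set v \<and> remove1 x v = w}"
      using assms(2) by (auto simp: words_on_def)
    then show "(\<Sum>v | v \<in> ?V \<and> remove1 x v = w. f v) = insertion_sum x f w"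
      using insertion_sum_eq[of x w f] w by (simp add: words_on_def)
  qed
  finally show ?thesis by simp
qed

text \<open>
  Letters outside \<open>r\<close> are removed one at a time, each time replacing \<open>f\<close> by a harmonic function that is
  still concentrated on words of length \<open>k\<close>. In the end only \<open>r\<close> is left, and it is too short to have
  subwords of length \<open>k\<close>.
\<close>

lemma sum_superwords_subword_sum_eq_0:
  assumes "finite A" "harmonic A f" "distinct r" "set r \<subseteq> A" "length r < k"
    and "\<And>v. distinct v \<Longrightarrow> set v \<subseteq> A \<Longrightarrow> length v \<noteq> k \<Longrightarrow> f v = 0"
  shows "(\<Sum>v | v \<in> words_on A \<and> subseq r v. subword_sum f v) = 0"
  using assms
proof (induction "card (A - set r)" arbitrary: A f)
  case 0
  then have A: "A = set r" by auto
  have "{v. v \<in> words_on A \<and> subseq r v} = {r}"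
  proof -
    have "v = r" if "v \<in> words_on A" "subseq r v" for v
    proof -
      have "length v = length r"
        using that A 0 by (metis (mono_tags, lifting) words_on_def distinct_card mem_Collect_eq)
      then show ?thesis using that(2) by (metis subseq_same_length)
    qed
    then show ?thesis using A 0 by (auto simp: words_on_def)
  qed
  moreover have "subword_sum f r = 0"
  proof (rule subword_sum_eq_0)
    fix v assume "subseq v r"
    then have "distinct v" "set v \<subseteq> A" "length v < k"
      using 0 A by (auto dest: distinct_subseq set_subseq list_emb_length)
    then show "f v = 0" using 0 by auto
  qed
  ultimately show ?case by simp
next
  case (Suc m)
  then obtain x where x: "x \<in> A" "x \<notin> set r"
    by (metis DiffE card.empty ex_in_conv nat.simps(3))
  define g where "g = (\<lambda>v. real (card A) * f v + replacement_sum x f v)"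
  have "g v = 0" if "distinct v" "set v \<subseteq> A - {x}" "length v \<noteq> k" for v
  proof -
    have "f (v[j := x]) = 0" if "j < length v" for j
    proof (rule Suc.prems(6))
      show "distinct (v[j := x])" using \<open>distinct v\<close> \<open>set v \<subseteq> _\<close> by (intro distinct_list_update) auto
      show "set (v[j := x]) \<subseteq> A"
        using set_update_subset_insert[of v j x] \<open>set v \<subseteq> _\<close> x by blast
    qed (use \<open>length v \<noteq> k\<close> in simp)
    then show ?thesis
      using that Suc.prems(6)[of v] by (auto simp: g_def replacement_sum_eq)
  qed
  moreover have "harmonic (A - {x}) g"
    unfolding g_def by (rule harmonic_replacement) fact+
  moreover have "m = card (A - {x} - set r)"
    using Suc.hyps(2) x Suc.prems(1) by (metis Diff_iff Diff_insert Diff_insert2 card_Diff_singleton diff_Suc_1)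
  ultimately have "(\<Sum>v | v \<in> words_on (A - {x}) \<and> subseq r v. subword_sum g v) = 0"
    using Suc.prems x by (intro Suc.hyps(1)) auto
  then show ?case
    using sum_superwords_remove[OF Suc.prems(1) x, of "subword_sum f"]
      harmonic_insertion_sum[OF Suc.prems(2,1) x(1)] by (simp add: g_def)
qed

text \<open>
  By the induction hypothesis for \<open>A - {x}\<close>, the function \<open>|A| f + S\<^sub>x f\<close> vanishes on the words that
  avoid \<open>x\<close>. At a word \<open>u\<close> with \<open>set u \<subset> A\<close> that maximizes \<open>|f u|\<close> this reads
  \<open>|A| |f u| \<le> |u| |f u|\<close>, which is impossible for \<open>f u \<noteq> 0\<close> because \<open>|u| < |A|\<close>. So \<open>f\<close> is
  concentrated on the words with content \<open>A\<close>, where it agrees with its sum over subwords.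
\<close>

lemma subword_sum_inj:
  assumes "finite A" "harmonic A f" "\<And>w. w \<in> words_on A \<Longrightarrow> subword_sum f w = 0"
    and "distinct v" "set v \<subseteq> A"
  shows "f v = 0"
  using assms
proof (induction "card A" arbitrary: A f v rule: less_induct)
  case less
  let ?P = "{v. distinct v \<and> set v \<subset> A}"
  have short: "f v = 0" if "v \<in> ?P" for v
  proof (rule ccontr)
    assume "f v \<noteq> 0"
    have fin: "finite ((\<lambda>v. \<bar>f v\<bar>) ` ?P)"
      by (intro finite_imageI finite_subset[OF _ finite_subset_distinct[OF less.prems(1)]]) auto
    have "Max ((\<lambda>v. \<bar>f v\<bar>) ` ?P) \<in> (\<lambda>v. \<bar>f v\<bar>) ` ?P"
      using fin that by (intro Max_in) auto
    then obtain u where u: "u \<in> ?P" and "Max ((\<lambda>v. \<bar>f v\<bar>) ` ?P) = \<bar>f u\<bar>" by (rule imageE)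
    then have max: "\<bar>f v\<bar> \<le> \<bar>f u\<bar>" if "v \<in> ?P" for v
      using Max_ge[OF fin, of "\<bar>f v\<bar>"] that by simp
    \<comment> \<open>The word \<open>u\<close> misses some letter, which drives the induction.\<close>
    obtain x where x: "x \<in> A" "x \<notin> set u" using u psubset_imp_ex_mem[of "set u" A] by blast
    define g where "g = (\<lambda>v. real (card A) * f v + replacement_sum x f v)"
    have g0: "g u = 0"
    proof (rule less.hyps)
      show "card (A - {x}) < card A" using x less.prems(1) by (intro psubset_card_mono) auto
      show "harmonic (A - {x}) g"
        unfolding g_def by (rule harmonic_replacement) fact+
      fix w assume w: "w \<in> words_on (A - {x})"
      then have "insertion_sum x (subword_sum f) w = 0"
      proof -
        have "x \<notin> set w" using w by (auto simp: words_on_def)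
        moreover have "subword_sum f v = 0" if "x \<in> set v" "remove1 x v = w" for v
          using that w x(1) by (intro less.prems(3)) (auto intro: words_on_remove1D)
        ultimately show ?thesis by (simp add: insertion_sum_eq)
      qed
      then show "subword_sum g w = 0"
        using harmonic_insertion_sum[OF less.prems(2,1) x(1) w] by (simp add: g_def)
    qed (use u x less.prems in auto)
    have le: "\<bar>f (u[j := x])\<bar> \<le> \<bar>f u\<bar>" if "j < length u" for j
    proof (rule max)
      have d: "distinct (u[j := x])" using u x by (intro distinct_list_update) auto
      have "card (set (u[j := x])) = card (set u)"
        using d u by (simp add: distinct_card)
      moreover have "card (set u) < card A"
        using u less.prems(1) by (auto intro: psubset_card_mono)
      moreover have "set (u[j := x]) \<subseteq> A"
        using set_update_subset_insert[of u j x] u x by blast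
      ultimately show "u[j := x] \<in> ?P" using d by auto
    qed
    have "real (card A) * \<bar>f u\<bar> = \<bar>\<Sum>j<length u. f (u[j := x])\<bar>"
    proof -
      have "real (card A) * f u = - (\<Sum>j<length u. f (u[j := x]))"
        using g0 by (simp add: g_def replacement_sum_eq)
      then show ?thesis by (metis abs_minus_cancel abs_mult abs_of_nat)
    qed
    also have "\<dots> \<le> (\<Sum>j<length u. \<bar>f u\<bar>)"
      by (rule order_trans[OF sum_abs sum_mono]) (use le in auto)
    finally have "real (card A) * \<bar>f u\<bar> \<le> real (length u) * \<bar>f u\<bar>" by simp
    moreover have "length u < card A"
      using u less.prems(1) by (metis (mono_tags, lifting) distinct_card mem_Collect_eq psubset_card_mono)
    moreover have "0 < \<bar>f u\<bar>" using max[OF that] \<open>f v \<noteq> 0\<close> by linarith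
    ultimately show False by simp
  qed
  show ?case
  proof (cases "set v = A")
    case True
    have "subword_sum f v = subword_sum (\<lambda>u. if u = v then f v else 0) v"
    proof (rule subword_sum_cong)
      fix u assume u: "subseq u v"
      then have "distinct u" "set u \<subseteq> A"
        using True less.prems by (auto dest: distinct_subseq set_subseq)
      moreover have "u = v" if "set u = A"
      proof -
        have "length u = length v"
          using that True \<open>distinct u\<close> less.prems(4) by (metis distinct_card)
        then show ?thesis using u by (metis subseq_same_length)
      qed
      ultimately show "f u = (if u = v then f v else 0)" using short[of u] by auto
    qed
    also have "\<dots> = f v"
      using less.prems(4) by (simp add: subword_sum_eq_sum finite_subseqs)
    finally show ?thesis using less.prems True by (simp add: words_on_def)
  qed (use short less.prems in auto)
qed

section \<open>Orthogonal projection in spaces of functions\<close>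

lemma fun_inner_add_left: "fun_inner X (f + g) h = fun_inner X f h + fun_inner X g h"
  by (simp add: fun_inner_def sum.distrib distrib_right)

lemma fun_inner_scaleR_left: "fun_inner X (c *\<^sub>R f) g = c * fun_inner X f g"
  by (simp add: fun_inner_def scaleR_fun_def sum_distrib_left mult.assoc)

lemma fun_inner_commute: "fun_inner X f g = fun_inner X g f"
  by (simp add: fun_inner_def mult.commute)

lemma fun_inner_add_right: "fun_inner X h (f + g) = fun_inner X h f + fun_inner X h g"
  using fun_inner_add_left by (metis fun_inner_commute)

lemma fun_inner_scaleR_right: "fun_inner X f (c *\<^sub>R g) = c * fun_inner X f g"
  using fun_inner_scaleR_left by (metis fun_inner_commute)

lemma fun_inner_diff_right: "fun_inner X h (f - g) = fun_inner X h f - fun_inner X h g"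
  using fun_inner_add_right[of X h "f - g" g] by simp

lemma fun_inner_self_eq_0:
  assumes "finite X" "fun_inner X f f = 0" "x \<in> X"
  shows "f x = 0"
  using assms sum_nonneg_eq_0_iff[OF assms(1), of "\<lambda>x. f x * f x"] by (auto simp: fun_inner_def)

lemma fun_inner_span_left:
  assumes "u \<in> span E" "\<And>e. e \<in> E \<Longrightarrow> fun_inner X e h = 0"
  shows "fun_inner X u h = 0"
  using assms(1)
proof (induction rule: span_induct_alt)
  case base
  then show ?case by (simp add: fun_inner_def)
next
  case (step c x y)
  then show ?case
    unfolding fun_inner_add_left fun_inner_scaleR_left using assms(2) by simp
qed

text \<open>
  Gram-Schmidt: for a new vector \<open>e\<close>, the projection \<open>u\<close> of \<open>f\<close> to the span of \<open>E\<close> is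
  corrected along the residual \<open>r\<close> of \<open>e\<close>.
\<close>

lemma orthogonal_decomposition:
  assumes "finite X" "finite E"
  shows "\<exists>u\<in>span E. \<forall>e\<in>E. fun_inner X e (f - u) = 0"
  using assms(2)
proof (induction E arbitrary: f rule: finite_induct)
  case empty
  then show ?case by simp
next
  case (insert e E)
  obtain v where v: "v \<in> span E" "\<forall>d\<in>E. fun_inner X d (e - v) = 0"
    using insert.IH by blast
  obtain u where u: "u \<in> span E" "\<forall>d\<in>E. fun_inner X d (f - u) = 0"
    using insert.IH by blast
  define r where "r = e - v"
  define c where "c = (if fun_inner X r r = 0 then 0 else fun_inner X r (f - u) / fun_inner X r r)"
  have span: "span E \<subseteq> span (insert e E)" by (intro span_mono) blast
  have "e \<in> span (insert e E)" by (intro span_base) simp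
  then have "u + c *\<^sub>R r \<in> span (insert e E)"
    unfolding r_def using span u(1) v(1) by (intro span_add span_scale span_diff) auto
  moreover have E: "fun_inner X d (f - (u + c *\<^sub>R r)) = 0" if "d \<in> E" for d
  proof -
    have "fun_inner X d (f - (u + c *\<^sub>R r)) = fun_inner X d (f - u) - c * fun_inner X d r"
      by (simp add: fun_inner_diff_right fun_inner_add_right fun_inner_scaleR_right)
    then show ?thesis using that u(2) v(2) by (simp add: r_def)
  qed
  moreover have "fun_inner X e (f - (u + c *\<^sub>R r)) = 0"
  proof -
    \<comment> \<open>If \<open>r\<close> has norm zero it vanishes on \<open>X\<close>, so that any \<open>c\<close> will do.\<close>
    have r: "fun_inner X r (f - (u + c *\<^sub>R r)) = 0"
    proof (cases "fun_inner X r r = 0")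
      case True
      then show ?thesis
        using fun_inner_self_eq_0[OF assms(1) True] by (simp add: fun_inner_def)
    next
      case False
      then show ?thesis
        by (simp add: c_def fun_inner_diff_right fun_inner_add_right fun_inner_scaleR_right)
    qed
    have "fun_inner X v (f - (u + c *\<^sub>R r)) = 0"
      by (rule fun_inner_span_left[OF v(1) E])
    moreover have "e = r + v" by (simp add: r_def)
    ultimately show ?thesis using r by (metis add_0 fun_inner_add_left)
  qed
  ultimately show ?case by blast
qed

section \<open>The embedding as a sum over subwords\<close>

lemma subspace_fun_space: "subspace (fun_space X)"
  by (auto simp: subspace_def fun_space_def scaleR_fun_def)

lemma phi_apply:
  "phi n f w = (\<Sum>v\<in>words0 n. fact (length v) / fact n * f v * indicator (full_words_over n v) w)"
  by (simp add: phi_def sum_fun_eval scaleR_fun_def)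

lemma linear_phi: "linear (phi n)"
proof (rule linearI)
  show "phi n (f + g) = phi n f + phi n g" for f g
    by (rule ext) (simp only: phi_apply plus_fun_apply distrib_left distrib_right sum.distrib)
  show "phi n (c *\<^sub>R f) = c *\<^sub>R phi n f" for c f
    by (rule ext) (simp only: phi_apply scaleR_fun_def real_scaleR_def sum_distrib_left
        mult.assoc mult.left_commute)
qed

lemma words0_iff: "w \<in> words0 n \<longleftrightarrow> distinct w \<and> set w \<subseteq> {1..n} \<and> length w \<noteq> 1"
proof (cases "distinct w")
  case True
  have "w \<in> words0 n \<longleftrightarrow> w = [] \<or> set w \<subseteq> {1..n} \<and> 2 \<le> length w"
    using True by (simp add: words0_def words_def big_subsets_def words_on_def distinct_card)
  also have "\<dots> \<longleftrightarrow> set w \<subseteq> {1..n} \<and> length w \<noteq> 1"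
  proof (cases "length w = 0")
    case False
    then have "2 \<le> length w \<longleftrightarrow> length w \<noteq> 1" by linarith
    then show ?thesis using False by simp
  qed simp
  finally show ?thesis using True by simp
qed (auto simp: words0_def words_def words_on_def)

lemma finite_words0: "finite (words0 n)"
  by (rule finite_subset[OF _ finite_subset_distinct[of "{1..n}"]]) (simp_all add: words0_iff subset_iff)

lemma full_words_iff: "w \<in> full_words n \<longleftrightarrow> distinct w \<and> set w = {1..n}"
  by (simp add: full_words_def words_on_def)

lemma full_words_subset_words0: "n \<noteq> 1 \<Longrightarrow> full_words n \<subseteq> words0 n"
proof
  fix w assume "n \<noteq> 1" "w \<in> full_words n"
  then have "distinct w" "set w = {1..n}" by (simp_all add: full_words_iff)
  moreover from this have "length w = n" using distinct_card[of w] by simp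
  ultimately show "w \<in> words0 n" using \<open>n \<noteq> 1\<close> by (simp add: words0_iff)
qed

lemma finite_full_words: "finite (full_words n)"
  by (simp add: full_words_def finite_words_on)

lemma phi_eq_subword_sum:
  assumes "f \<in> fun_space (words0 n)" "w \<in> full_words n"
  shows "phi n f w = subword_sum (\<lambda>v. fact (length v) / fact n * f v) w"
proof -
  have w: "distinct w" "set w = {1..n}" using assms(2) by (simp_all add: full_words_iff)
  have "phi n f w = (\<Sum>v\<in>words0 n. fact (length v) / fact n * f v * indicator (full_words_over n v) w)"
    by (rule phi_apply)
  also have "\<dots> = (\<Sum>v | v \<in> words0 n \<and> subseq v w. fact (length v) / fact n * f v)"
    using assms(2) unfolding sum.inter_filter[OF finite_words0]
    by (intro sum.cong) (simp_all add: full_words_over_def)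
  also have "\<dots> = (\<Sum>v | subseq v w. fact (length v) / fact n * f v)"
    using assms(1) by (intro sum.mono_neutral_left finite_subseqs) (auto simp: fun_space_def)
  finally show ?thesis using w by (simp add: subword_sum_eq_sum)
qed

lemma phi_in_fun_space: "phi n f \<in> fun_space (full_words n)"
  by (simp add: fun_space_def phi_def sum_fun_eval scaleR_fun_def full_words_over_def indicator_def)

text \<open>
  The factor \<open>|v|! / n!\<close> in the definition of the embedding is harmless: insertions into \<open>w\<close> all have
  the same length.
\<close>

lemma harmonic_weight:
  assumes "harmonic A f"
  shows "harmonic A (\<lambda>v. c (length v) * f v)"
proof -
  have "insertion_sum x (\<lambda>v. c (length v) * f v) w = c (Suc (length w)) * insertion_sum x f w"
    for x w
  proof (induction w arbitrary: f c)
    case (Cons a w)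
    then show ?case
      using Cons[of "\<lambda>m. c (Suc m)" "\<lambda>v. f (a # v)"] by (simp add: algebra_simps)
  qed simp
  then show ?thesis using assms by (simp add: harmonic_def)
qed

section \<open>Vanishing marginals are harmonicity\<close>

definition harmonic_space :: "nat \<Rightarrow> (nat list \<Rightarrow> real) set"
  where "harmonic_space n = {f \<in> fun_space (words0 n). harmonic {1..n} f}"

lemma subspace_harmonic_space: "subspace (harmonic_space n)"
proof -
  have "insertion_sum x (f + g) w = insertion_sum x f w + insertion_sum x g w"
    "insertion_sum x (c *\<^sub>R f) w = c * insertion_sum x f w"
    for x w c and f g :: "nat list \<Rightarrow> real"
    using insertion_sum_add[of x f g w] insertion_sum_mult[of x c f w]
    by (simp_all add: scaleR_fun_def plus_fun_def)
  moreover have "insertion_sum x (0 :: nat list \<Rightarrow> real) w = 0" for x w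
    using insertion_sum_mult[of x 0 "\<lambda>_. 0" w] by (simp add: zero_fun_def)
  ultimately show ?thesis
    using subspace_fun_space[of "words0 n"]
    by (simp add: harmonic_space_def subspace_def harmonic_def)
qed

lemma length_words_on: "w \<in> words_on A \<Longrightarrow> length w = card A"
  unfolding words_on_def using distinct_card by force

lemma superwords_words_on:
  assumes "w \<in> words_on A"
  shows "{v. v \<in> words_on A \<and> subseq w v} = {w}"
proof -
  have "v = w" if "v \<in> words_on A" "subseq w v" for v
    using that assms length_words_on[of v A] length_words_on[of w A] subseq_same_length[of w v] by simp
  then show ?thesis using assms by auto
qed

lemma set_remove1_insert: "x \<in> set v \<Longrightarrow> set v = insert x (set (remove1 x v))"
  by (induction v) auto

text \<open>
  If all proper marginals vanish, then so does the one for \<open>B - {x}\<close>, whose values are the insertion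
  sums of \<open>f\<close>. Conversely, a marginal for a proper subset of \<open>B\<close> omits some letter \<open>x\<close> of \<open>B\<close>, and
  grouping its terms by deletion of \<open>x\<close> writes it as a sum of insertion sums. Marginals for sets with
  at most one element are total sums; these agree with the sum over the superwords of any word
  over \<open>B\<close> of length at most one.
\<close>

lemma H_set_eq:
  assumes "B \<in> big_subsets0 {1..n}"
  shows "H_set n B = {f \<in> fun_space (words_on B). harmonic {1..n} f}"
proof (cases "B = {}")
  case True
  have "f \<in> span {dirac []}" if "f \<in> fun_space (words_on {})" for f :: "nat list \<Rightarrow> real"
  proof -
    have "f = f [] *\<^sub>R dirac []"
      using that by (auto simp: fun_space_def words_on_def scaleR_fun_def dirac_def fun_eq_iff)
    then show ?thesis by (auto simp: span_singleton)
  qed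
  moreover have "harmonic {1..n} f" if "f \<in> fun_space (words_on {})" for f :: "nat list \<Rightarrow> real"
    unfolding harmonic_def
  proof (intro allI impI)
    fix x w assume "distinct (x # w) \<and> set (x # w) \<subseteq> {1..n}"
    then have "insertion_sum x f w = (\<Sum>v | x \<in> set v \<and> remove1 x v = w. f v)"
      by (simp add: insertion_sum_eq)
    also have "\<dots> = 0"
    proof (intro sum.neutral ballI)
      fix v assume "v \<in> {v. x \<in> set v \<and> remove1 x v = w}"
      then have "v \<notin> words_on {}" by (auto simp: words_on_def)
      then show "f v = 0" using that by (simp add: fun_space_def)
    qed
    finally show "insertion_sum x f w = 0" .
  qed
  ultimately show ?thesis
    using True H_set_support[of _ n "{}"] by (auto simp: H_set_def)
next
  case False
  then have B: "B \<subseteq> {1..n}" "2 \<le> card B" using assms by (auto simp: big_subsets0_def big_subsets_def)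
  have fB: "finite B" using B(1) by (rule finite_subset) simp
  have sub: "words_on B \<subseteq> words n" "words_on B \<subseteq> words0 n"
    using B by (auto simp: words_def words0_def big_subsets_def)
  have fin: "finite (words n)" using finite_words0[of n] by (simp add: words0_def)
  have sup: "(\<Sum>w\<in>{w \<in> words n. subseq r w}. f w) = (\<Sum>w | w \<in> words_on B \<and> subseq r w. f w)"
    if "f \<in> fun_space (words_on B)" for f r
    using that sub fin by (intro sum.mono_neutral_right) (auto simp: fun_space_def)
  have tot: "(\<Sum>w\<in>words0 n. f w) = (\<Sum>w | w \<in> words_on B \<and> subseq r w. f w)"
    if "f \<in> fun_space (words_on B)" "set r \<subseteq> B" "length r \<le> 1" for f r
  proof -
    have "subseq r w" if "w \<in> words_on B" for w
      using \<open>set r \<subseteq> B\<close> \<open>length r \<le> 1\<close> that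
      by (cases r) (auto simp: words_on_def subseq_singleton_left)
    then show ?thesis
      using that(1) sub(2) by (intro sum.mono_neutral_right finite_words0) (auto simp: fun_space_def)
  qed
  have "(\<forall>B'. B' \<subset> B \<longrightarrow> marginal n B' f = 0) \<longleftrightarrow> harmonic {1..n} f"
    if f: "f \<in> fun_space (words_on B)" for f
  proof
    assume m: "\<forall>B'. B' \<subset> B \<longrightarrow> marginal n B' f = 0"
    show "harmonic {1..n} f"
      unfolding harmonic_def
    proof (intro allI impI)
      fix x w assume xw: "distinct (x # w) \<and> set (x # w) \<subseteq> {1..n}"
      show "insertion_sum x f w = 0"
      proof (cases "set (x # w) = B")
        case True
        then have w: "w \<in> words_on (B - {x})" "x \<in> B" using xw by (auto simp: words_on_def)
        then have m0: "marginal n (B - {x}) f = 0" using m by blast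
        have card: "card (B - {x}) = length w"
          using w(1) by (simp add: length_words_on)
        have eq: "(\<Sum>v | v \<in> words_on B \<and> subseq w v. f v) = insertion_sum x f w"
          using sum_superwords_remove[OF fB w(2), of w f] xw superwords_words_on[OF w(1)] by simp
        show ?thesis
        proof (cases "card (B - {x}) \<le> 1")
          case True
          then have "(\<Sum>w\<in>words0 n. f w) = 0"
            using fun_cong[OF m0, of "[]"] by (simp add: marginal_def scaleR_fun_def dirac_def)
          then show ?thesis
            using tot[OF f, of w] eq card True w by (auto simp: words_on_def)
        next
          case False
          then show ?thesis
            using fun_cong[OF m0, of w] w eq sup[OF f, of w] by (simp add: marginal_def)
        qed
      next
        case False
        have "f v = 0" if "x \<in> set v" "remove1 x v = w" for v
        proof -
          have "set v = insert x (set w)"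
            using set_remove1_insert[OF that(1)] that(2) by simp
          then show ?thesis using f False by (auto simp: fun_space_def words_on_def)
        qed
        then show ?thesis using xw by (simp add: insertion_sum_eq)
      qed
    qed
  next
    assume h: "harmonic {1..n} f"
    have super: "(\<Sum>v | v \<in> words_on B \<and> subseq r v. f v) = 0" if r: "set r \<subset> B" for r
    proof -
      obtain x where x: "x \<in> B" "x \<notin> set r" using r by blast
      then have "(\<Sum>v | v \<in> words_on B \<and> subseq r v. f v) =
          (\<Sum>w | w \<in> words_on (B - {x}) \<and> subseq r w. insertion_sum x f w)"
        by (rule sum_superwords_remove[OF fB])
      also have "\<dots> = 0"
      proof (intro sum.neutral ballI)
        fix w assume "w \<in> {w. w \<in> words_on (B - {x}) \<and> subseq r w}"
        then have w: "distinct w" "set w = B - {x}" by (simp_all add: words_on_def)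
        then have "distinct (x # w) \<and> set (x # w) \<subseteq> {1..n}"
          using subsetD[OF B(1) x(1)] B(1) by auto
        then show "insertion_sum x f w = 0" using h unfolding harmonic_def by blast
      qed
      finally show ?thesis .
    qed
    show "\<forall>B'. B' \<subset> B \<longrightarrow> marginal n B' f = 0"
    proof (intro allI impI)
      fix B' assume B': "B' \<subset> B"
      have "{} \<subset> B" using False by blast
      then have "(\<Sum>w\<in>words0 n. f w) = 0" using super[of "[]"] tot[OF f, of "[]"] by simp
      moreover have "(\<Sum>\<sigma>\<in>{\<sigma> \<in> words n. subseq r \<sigma>}. f \<sigma>) = 0" if "r \<in> words_on B'" for r
        using that B' super[of r] sup[OF f, of r] by (auto simp: words_on_def)
      ultimately show "marginal n B' f = 0"
        by (auto simp: marginal_def fun_eq_iff scaleR_fun_def)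
    qed
  qed
  then show ?thesis using False by (auto simp: H_set_def)
qed

text \<open>
  A harmonic function splits into its restrictions to the words with a given content, and these are
  again harmonic because all insertions of \<open>x\<close> into \<open>w\<close> share one content.
\<close>

lemma sum_of_H_set_eq:
  assumes "I \<subseteq> big_subsets0 {1..n}"
  shows "sum_of_subspaces I (H_set n) = {f \<in> harmonic_space n. \<forall>w. set w \<notin> I \<longrightarrow> f w = 0}"
proof (intro Set.set_eqI iffI)
  have finI: "finite I"
    by (rule finite_subset[of _ "Pow {1..n}"])
      (use assms in \<open>auto simp: big_subsets0_def big_subsets_def\<close>)
  have words: "words_on B \<subseteq> words0 n" if "B \<in> I" for B
    using assms that by (auto simp: words0_def words_def big_subsets0_def words_on_def)
  fix f
  {
    assume "f \<in> sum_of_subspaces I (H_set n)"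
    then obtain u where f: "f = (\<Sum>B\<in>I. u B)" and u: "\<forall>B\<in>I. u B \<in> H_set n B"
      by (auto simp: sum_of_subspaces_def)
    have uB: "u B \<in> fun_space (words_on B)" "harmonic {1..n} (u B)" if "B \<in> I" for B
      using u H_set_eq[of B n] assms that by auto
    then have "u B \<in> harmonic_space n" if "B \<in> I" for B
      using words[OF that] uB[OF that] by (auto simp: harmonic_space_def fun_space_def)
    then have "f \<in> harmonic_space n"
      unfolding f by (intro subspace_sum subspace_harmonic_space)
    moreover have "f w = 0" if "set w \<notin> I" for w
    proof -
      have "u B w = 0" if "B \<in> I" for B
        using uB(1)[OF that] \<open>set w \<notin> I\<close> that by (auto simp: fun_space_def words_on_def)
      then show ?thesis by (simp add: f sum_fun_eval)
    qed
    ultimately show "f \<in> {f \<in> harmonic_space n. \<forall>w. set w \<notin> I \<longrightarrow> f w = 0}" by simp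
  next
    assume "f \<in> {f \<in> harmonic_space n. \<forall>w. set w \<notin> I \<longrightarrow> f w = 0}"
    then have f: "f \<in> fun_space (words0 n)" "harmonic {1..n} f" and off: "\<And>w. set w \<notin> I \<Longrightarrow> f w = 0"
      by (simp_all add: harmonic_space_def)
    define u where "u B = (\<lambda>w. if set w = B then f w else 0)" for B
    have "u B \<in> H_set n B" if "B \<in> I" for B
    proof -
      have "harmonic {1..n} (u B)"
        unfolding harmonic_def
      proof (intro allI impI)
        fix x w assume xw: "distinct (x # w) \<and> set (x # w) \<subseteq> {1..n}"
        let ?S = "{v. x \<in> set v \<and> remove1 x v = w}"
        have "u B v = (if insert x (set w) = B then f v else 0)" if "v \<in> ?S" for v
          using that set_remove1_insert[of x v] by (simp add: u_def)
        then have "(\<Sum>v\<in>?S. u B v) = (\<Sum>v\<in>?S. if insert x (set w) = B then f v else 0)"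
          by (rule sum.cong[OF refl])
        then have "insertion_sum x (u B) w =
            (if insert x (set w) = B then insertion_sum x f w else 0)"
          using xw by (simp add: insertion_sum_eq)
        then show "insertion_sum x (u B) w = 0" using f(2) xw by (simp add: harmonic_def)
      qed
      moreover have "u B \<in> fun_space (words_on B)"
        using f(1) by (auto simp: u_def fun_space_def words0_iff words_on_def)
      ultimately show ?thesis using H_set_eq[of B n] assms that by auto
    qed
    moreover have "f = (\<Sum>B\<in>I. u B)"
    proof
      fix w
      show "f w = (\<Sum>B\<in>I. u B) w"
        using finI off[of w] by (simp add: sum_fun_eval u_def)
    qed
    ultimately show "f \<in> sum_of_subspaces I (H_set n)"
      by (auto simp: sum_of_subspaces_def)
  }
qed

lemma H_total_eq: "H_total n = harmonic_space n"
proof -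
  have "w \<notin> words0 n" if "set w \<notin> big_subsets0 {1..n}" for w
    using that by (auto simp: words0_def words_def words_on_def big_subsets0_def)
  then show ?thesis
    by (auto simp: H_total_def sum_of_H_set_eq harmonic_space_def fun_space_def)
qed

lemma H_level_eq: "H_level n k = harmonic_space n \<inter> fun_space (words_of_length n k)"
proof -
  have "w \<notin> words0 n \<or> w \<notin> words_of_length n k" if "set w \<notin> {B \<in> big_subsets0 {1..n}. card B = k}" for w
    using that by (auto simp: words0_def words_def words_on_def big_subsets0_def words_of_length_def
        distinct_card)
  moreover have "w \<in> words_of_length n k"
    if "set w \<in> {B \<in> big_subsets0 {1..n}. card B = k}" "w \<in> words0 n" for w
    using that by (auto simp: words0_iff words_of_length_def distinct_card)
  ultimately show ?thesis
    unfolding H_level_def by (subst sum_of_H_set_eq) (auto simp: harmonic_space_def fun_space_def)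
qed

section \<open>The filtration by subword length\<close>

text \<open>
  This is \<open>V\<^sup>k\<close> for \<open>k \<noteq> 1\<close>; including \<open>k = 1\<close>, where it coincides with \<open>V\<^sup>0\<close> as soon as
  \<open>n \<ge> 1\<close>, makes the predecessor of level \<open>k\<close> uniformly level \<open>k - 1\<close>.
\<close>

definition subword_span :: "nat \<Rightarrow> nat \<Rightarrow> (nat list \<Rightarrow> real) set"
  where "subword_span n k = span ((\<lambda>w. indicator (full_words_over n w)) ` words_of_length n k)"

lemma words_of_length_subset_words0: "k \<noteq> 1 \<Longrightarrow> words_of_length n k \<subseteq> words0 n"
  by (auto simp only: words_of_length_def words0_iff)

lemma finite_words_of_length: "finite (words_of_length n k)"
  by (rule finite_subset[OF _ finite_subset_distinct[of "{1..n}"]])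
    (auto simp only: words_of_length_def finite_atLeastAtMost)

lemma full_words_eq: "full_words n = words_of_length n n"
proof -
  have "set w = {1..n} \<longleftrightarrow> set w \<subseteq> {1..n} \<and> length w = n" if "distinct w" for w :: "nat list"
    using that card_subset_eq[of "{1..n}" "set w"] by (auto simp: distinct_card[symmetric])
  then show ?thesis by (auto simp only: full_words_iff words_of_length_def)
qed

lemma full_words_over_short:
  assumes "set w \<subseteq> {1..n}" "length w \<le> 1"
  shows "full_words_over n w = full_words n"
  using assms by (cases w) (auto simp: full_words_over_def full_words_iff subseq_singleton_left)

lemma phi_dirac:
  assumes "w \<in> words0 n"
  shows "phi n (dirac w) = (fact (length w) / fact n) *\<^sub>R indicator (full_words_over n w)"
proof
  fix v
  have "phi n (dirac w) v = (\<Sum>u\<in>words0 n. if u = w then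
      fact (length w) / fact n * indicator (full_words_over n w) v else 0)"
    unfolding phi_apply by (intro sum.cong) (simp_all add: dirac_def)
  then show "phi n (dirac w) v = ((fact (length w) / fact n) *\<^sub>R indicator (full_words_over n w)) v"
    using assms finite_words0 by (simp add: scaleR_fun_def)
qed

lemma V_space_eq:
  assumes "k \<noteq> 1"
  shows "V_space n k = subword_span n k"
proof (cases "k = 0")
  case True
  have "words_of_length n 0 = {[]}" by (auto simp: words_of_length_def)
  then show ?thesis using True by (simp add: V_space_def subword_span_def full_words_over_short)
next
  case False
  have W: "words_of_length n k \<subseteq> words0 n" by (rule words_of_length_subset_words0[OF assms])
  have "phi n u \<in> subword_span n k" if "u \<in> fun_space (words_of_length n k)" for u
    unfolding phi_def
  proof (rule subspace_sum)
    show "subspace (subword_span n k)" by (simp add: subword_span_def)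
    fix w
    show "(fact (length w) / fact n * u w) *\<^sub>R indicator (full_words_over n w) \<in> subword_span n k"
    proof (cases "w \<in> words_of_length n k")
      case True
      then show ?thesis unfolding subword_span_def by (intro span_scale span_base) blast
    next
      case False
      then have "u w = 0" using that by (simp add: fun_space_def)
      then show ?thesis by (simp add: subword_span_def span_zero)
    qed
  qed
  moreover have "subword_span n k \<subseteq> phi n ` fun_space (words_of_length n k)"
    unfolding subword_span_def
  proof (rule span_minimal)
    show "subspace (phi n ` fun_space (words_of_length n k))"
      by (rule linear_subspace_image[OF linear_phi subspace_fun_space])
    show "(\<lambda>w. indicator (full_words_over n w)) ` words_of_length n k
        \<subseteq> phi n ` fun_space (words_of_length n k)"
    proof (rule image_subsetI)
      fix w assume w: "w \<in> words_of_length n k"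
      have "phi n ((fact n / fact (length w)) *\<^sub>R dirac w) = indicator (full_words_over n w)"
        using W w by (simp add: linear_scale[OF linear_phi] phi_dirac subset_iff)
      moreover have "(fact n / fact (length w)) *\<^sub>R dirac w \<in> fun_space (words_of_length n k)"
        using w by (auto simp: fun_space_def scaleR_fun_def dirac_def)
      ultimately show "indicator (full_words_over n w) \<in> phi n ` fun_space (words_of_length n k)"
        by (metis imageI)
    qed
  qed
  ultimately show ?thesis using False by (auto simp: V_space_def)
qed

lemma subword_span_1:
  assumes "1 \<le> n"
  shows "subword_span n 1 = subword_span n 0"
proof -
  have "[1] \<in> words_of_length n 1" "[] \<in> words_of_length n 0"
    using assms by (simp_all add: words_of_length_def)
  moreover have "full_words_over n w = full_words n"
    if "w \<in> words_of_length n 0 \<union> words_of_length n 1" for w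
    using that full_words_over_short[of w n] by (auto simp: words_of_length_def)
  ultimately have "(\<lambda>w. indicator (full_words_over n w) :: _ \<Rightarrow> real) ` words_of_length n k
      = {indicator (full_words n)}"
    if "k = 0 \<or> k = 1" for k
    using that by (auto simp: image_iff)
  then show ?thesis by (simp add: subword_span_def)
qed

lemma V_space_pred:
  assumes "2 \<le> k" "1 \<le> n"
  shows "V_space n (if k = 2 then 0 else k - 1) = subword_span n (k - 1)"
  using assms subword_span_1[of n] by (simp add: V_space_eq)

lemma phi_inner_superwords:
  assumes f: "f \<in> H_level n k" and w: "w \<in> words_of_length n j" "j < k"
  shows "fun_inner (full_words n) (indicator (full_words_over n w)) (phi n f) = 0"
proof -
  let ?g = "\<lambda>v. fact (length v) / fact n * f v"
  have f': "f \<in> fun_space (words0 n)" "harmonic {1..n} f" "f \<in> fun_space (words_of_length n k)"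
    using f by (simp_all add: H_level_eq harmonic_space_def)
  have "fun_inner (full_words n) (indicator (full_words_over n w)) (phi n f) =
      (\<Sum>v\<in>full_words n. if subseq w v then subword_sum ?g v else 0)"
    unfolding fun_inner_def using phi_eq_subword_sum[OF f'(1)]
    by (intro sum.cong) (simp_all add: full_words_over_def)
  also have "\<dots> = (\<Sum>v | v \<in> words_on {1..n} \<and> subseq w v. subword_sum ?g v)"
    unfolding full_words_def by (rule sum.inter_filter[symmetric]) (simp add: finite_words_on)
  also have "\<dots> = 0"
    using w f'(3) harmonic_weight[OF f'(2), of "\<lambda>m. fact m / fact n"]
    by (intro sum_superwords_subword_sum_eq_0[where k = k]) (auto simp: words_of_length_def fun_space_def)
  finally show ?thesis .
qed

lemma phi_orthogonal_subword_span:
  assumes "f \<in> H_level n k" "g \<in> subword_span n j" "j < k"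
  shows "fun_inner (full_words n) g (phi n f) = 0"
  using assms(2) unfolding subword_span_def
  by (rule fun_inner_span_left) (use assms(1,3) phi_inner_superwords in blast)

lemma subseq_eq_filter:
  assumes "subseq v s" "distinct s"
  shows "v = filter (\<lambda>a. a \<in> set v) s"
proof (rule subseq_same_length)
  show "subseq v (filter (\<lambda>a. a \<in> set v) s)"
    using subseq_filter[OF assms(1), of "\<lambda>a. a \<in> set v"] by simp
  have "set (filter (\<lambda>a. a \<in> set v) s) = set v" using set_subseq[OF assms(1)] by auto
  then show "length v = length (filter (\<lambda>a. a \<in> set v) s)"
    using assms(2) distinct_subseq[OF assms] by (metis distinct_card distinct_filter)
qed

text \<open>
  Inside an injective word \<open>s\<close> a subword is determined by its content, so among the insertions of \<open>x\<close>
  into a subword \<open>w\<close> of \<open>s\<close> exactly one is again a subword of \<open>s\<close>.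
\<close>

lemma subseq_insertions:
  assumes "distinct s" "x \<in> set s" "x \<notin> set w"
  shows "{v. subseq v s \<and> x \<in> set v \<and> remove1 x v = w} =
    (if subseq w s then {filter (\<lambda>a. a \<in> insert x (set w)) s} else {})"
proof -
  have 1: "subseq w s" "v = filter (\<lambda>a. a \<in> insert x (set w)) s"
    if v: "subseq v s" "x \<in> set v" "remove1 x v = w" for v
  proof -
    have "set v = insert x (set w)" using set_remove1_insert[OF v(2)] v(3) by simp
    then show "v = filter (\<lambda>a. a \<in> insert x (set w)) s"
      using subseq_eq_filter[OF v(1) assms(1)] by simp
    show "subseq w s" using v subseq_remove1_iff[of x w v] assms(3) subseq_order.trans by auto
  qed
  have 2: "remove1 x (filter (\<lambda>a. a \<in> insert x (set w)) s) = w" if "subseq w s"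
  proof -
    let ?v = "filter (\<lambda>a. a \<in> insert x (set w)) s"
    have "remove1 x ?v = filter (\<lambda>a. a \<noteq> x) ?v"
      using assms(1) by (simp add: distinct_remove1_removeAll removeAll_filter_not_eq eq_commute)
    also have "\<dots> = filter (\<lambda>a. a \<in> set w) s"
      using assms(3) by (auto intro!: filter_cong)
    also have "\<dots> = w" using subseq_eq_filter[OF that assms(1)] by simp
    finally show ?thesis .
  qed
  show ?thesis using 1 2 assms(2) by auto
qed

text \<open>
  This is what drops the level by one: the left-hand side comes from words of length \<open>|w| + 1\<close>,
  the right-hand side from the single word \<open>w\<close>.
\<close>

lemma phi_insertions:
  assumes "distinct (x # w)" "set (x # w) \<subseteq> {1..n}" "w \<noteq> []"
  shows "phi n (indicator {v. x \<in> set v \<and> remove1 x v = w}) =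
    (fact (Suc (length w)) / fact n) *\<^sub>R indicator (full_words_over n w)" (is "phi n ?e = ?c *\<^sub>R _")
proof
  fix s
  have len: "length v = Suc (length w)" if "x \<in> set v" "remove1 x v = w" for v
    using that length_pos_if_in_set[of x v] by (auto simp: length_remove1)
  have e: "?e \<in> fun_space (words0 n)"
    unfolding fun_space_def
  proof (intro CollectI allI impI)
    fix v assume "v \<notin> words0 n"
    moreover have "v \<in> words0 n" if v: "x \<in> set v" "remove1 x v = w"
    proof -
      have "w \<in> words_on (insert x (set w) - {x})" using assms(1) by (auto simp: words_on_def)
      then have "v \<in> words_on (insert x (set w))"
        using words_on_remove1D[OF v(1), of "insert x (set w)"] v(2) by simp
      then show ?thesis
        using assms(2,3) len[OF v] by (auto simp: words_on_def words0_iff)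
    qed
    ultimately show "?e v = 0" by (auto simp: indicator_def)
  qed
  show "phi n ?e s = (?c *\<^sub>R indicator (full_words_over n w)) s"
  proof (cases "s \<in> full_words n")
    case False
    then show ?thesis
      using phi_in_fun_space[of n ?e] by (simp add: fun_space_def scaleR_fun_def full_words_over_def)
  next
    case True
    then have s: "distinct s" "x \<in> set s" using assms(2) by (auto simp: full_words_iff)
    have "phi n ?e s = (\<Sum>v | subseq v s. if x \<in> set v \<and> remove1 x v = w then ?c else 0)"
      unfolding phi_eq_subword_sum[OF e True] subword_sum_eq_sum[OF s(1)]
      using len by (intro sum.cong) (auto simp: indicator_def)
    also have "\<dots> = (\<Sum>v | subseq v s \<and> x \<in> set v \<and> remove1 x v = w. ?c)"
      using sum.inter_filter[OF finite_subseqs[of s], of "\<lambda>_. ?c"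
          "\<lambda>v. x \<in> set v \<and> remove1 x v = w"] by (simp add: conj_assoc)
    also have "\<dots> = (if subseq w s then ?c else 0)"
      using subseq_insertions[OF s, of w] assms(1) by simp
    finally show ?thesis
      using True by (simp add: scaleR_fun_def full_words_over_def)
  qed
qed

text \<open>
  The function \<open>u\<close> is projected orthogonally, inside \<open>L(\<Gamma>\<^sup>k)\<close>, onto the span of the indicators of
  insertion sets. The residual \<open>h\<close> has vanishing insertion sums, since these are its inner products with the
  indicators, and the projection is mapped into level \<open>k - 1\<close>.
\<close>

lemma phi_decomposition:
  assumes k: "2 \<le> k" and u: "u \<in> fun_space (words_of_length n k)"
  obtains h where "h \<in> H_level n k" "phi n u - phi n h \<in> subword_span n (k - 1)"
proof -
  let ?X = "words_of_length n k"
  \<comment> \<open>The indicators in \<open>?E\<close> span the orthogonal complement of the harmonic functions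
    in \<open>L(\<Gamma>\<^sup>k)\<close>.\<close>
  let ?ins = "\<lambda>(x, w). {v. x \<in> set v \<and> remove1 x v = w}"
  let ?P = "{(x, w). x \<in> {1..n} - set w \<and> w \<in> words_of_length n (k - 1)}"
  let ?E = "(\<lambda>p. indicator (?ins p) :: nat list \<Rightarrow> real) ` ?P"
  have "finite ?P"
    by (rule finite_subset[of _ "{1..n} \<times> words_of_length n (k - 1)"])
      (auto intro: finite_words_of_length)
  then obtain e where e: "e \<in> span ?E" "\<forall>d\<in>?E. fun_inner ?X d (u - e) = 0"
    using orthogonal_decomposition[OF finite_words_of_length, of ?E n k u] by blast
  have ins: "v \<in> ?X" if "w \<in> words_of_length n (k - 1)" "x \<in> {1..n} - set w"
    "x \<in> set v" "remove1 x v = w" for x w v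
  proof -
    have "w \<in> words_on (insert x (set w) - {x})"
      using that(1,2) by (auto simp: words_on_def words_of_length_def)
    then have v: "v \<in> words_on (insert x (set w))"
      using words_on_remove1D[OF that(3), of "insert x (set w)"] that(4) by simp
    then have "length v = k"
      using length_words_on[OF v] that(1,2) k by (auto simp: words_of_length_def distinct_card)
    then show ?thesis using v that(1,2) by (auto simp: words_on_def words_of_length_def)
  qed
  have "?E \<subseteq> fun_space ?X" using ins by (fastforce simp: fun_space_def indicator_def)
  then have "e \<in> fun_space ?X" using e(1) span_minimal[OF _ subspace_fun_space] by blast
  then have hX: "u - e \<in> fun_space ?X" using u by (intro subspace_diff subspace_fun_space)
  have "harmonic {1..n} (u - e)"
    unfolding harmonic_def
  proof (intro allI impI)
    fix x w assume xw: "distinct (x # w) \<and> set (x # w) \<subseteq> {1..n}"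
    let ?S = "{v. x \<in> set v \<and> remove1 x v = w}"
    have S: "finite ?S" "insertion_sum x (u - e) w = (\<Sum>v\<in>?S. (u - e) v)"
      using insertion_sum_eq[of x w "u - e"] xw by simp_all
    show "insertion_sum x (u - e) w = 0"
    proof (cases "length w = k - 1")
      case True
      then have w: "w \<in> words_of_length n (k - 1)" "x \<in> {1..n} - set w"
        using xw by (simp_all add: words_of_length_def)
      then have "?S \<subseteq> ?X" using ins by blast
      then have "(\<Sum>v\<in>?S. (u - e) v) = (\<Sum>v\<in>?X. indicator ?S v * (u - e) v)"
        by (intro sum.mono_neutral_cong_left finite_words_of_length) (auto simp: indicator_def)
      also have "\<dots> = fun_inner ?X (indicator (?ins (x, w))) (u - e)"
        by (simp add: fun_inner_def)
      also have "\<dots> = 0" using e(2) w by blast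
      finally show ?thesis using S(2) by simp
    next
      case False
      have "(u - e) v = 0" if "v \<in> ?S" for v
      proof -
        have "length w = length v - 1" using that by (auto simp: length_remove1)
        then have "v \<notin> ?X" using False by (auto simp: words_of_length_def)
        then show ?thesis using hX unfolding fun_space_def by blast
      qed
      then show ?thesis using S(2) by simp
    qed
  qed
  moreover have "u - e \<in> fun_space (words0 n)"
    using hX words_of_length_subset_words0[of k n] k by (auto simp: fun_space_def)
  ultimately have "u - e \<in> H_level n k"
    using hX by (simp add: H_level_eq harmonic_space_def)
  moreover have "phi n e \<in> subword_span n (k - 1)"
  proof -
    have "phi n ` ?E \<subseteq> subword_span n (k - 1)"
      unfolding image_image
    proof (rule image_subsetI)
      fix p assume p: "p \<in> ?P"
      obtain x w where xw: "p = (x, w)" by (cases p)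
      then have "x \<in> {1..n} - set w" and w: "w \<in> words_of_length n (k - 1)" using p by auto
      then have "phi n (indicator (?ins p)) =
          (fact (Suc (length w)) / fact n) *\<^sub>R indicator (full_words_over n w)"
        unfolding xw split using k by (intro phi_insertions) (auto simp: words_of_length_def)
      moreover have "\<dots> \<in> subword_span n (k - 1)"
        unfolding subword_span_def using w by (intro span_scale span_base) blast
      ultimately show "phi n (indicator (?ins p)) \<in> subword_span n (k - 1)" by metis
    qed
    then have "span (phi n ` ?E) \<subseteq> subword_span n (k - 1)"
      by (rule span_minimal) (simp add: subword_span_def)
    moreover have "phi n e \<in> span (phi n ` ?E)"
      unfolding linear_span_image[OF linear_phi] by (rule imageI[OF e(1)])
    ultimately show ?thesis by (rule subsetD)
  qed
  moreover have "phi n u - phi n (u - e) = phi n e"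
    by (simp add: linear_diff[OF linear_phi])
  ultimately show ?thesis using that by metis
qed

text \<open>
  For \<open>f\<close> in \<open>W\<^sup>k\<close> the part of \<open>f\<close> in level \<open>k - 1\<close> given by the decomposition is a difference of two
  functions orthogonal to that level, so it is orthogonal to itself.
\<close>

lemma W_space_eq:
  assumes k: "k \<in> {2..n}"
  shows "W_space n k = phi n ` H_level n k"
proof (intro subset_antisym subsetI)
  have k2: "2 \<le> k" "1 \<le> n" "k \<noteq> 0" using k by auto
  have V: "V_space n (if k = 2 then 0 else k - 1) = subword_span n (k - 1)"
    by (rule V_space_pred[OF k2(1,2)])
  fix f
  {
    assume "f \<in> phi n ` H_level n k"
    then obtain h where h: "h \<in> H_level n k" "f = phi n h" by blast
    then have "f \<in> V_space n k" using k2 by (simp add: V_space_def H_level_eq)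
    moreover have "fun_inner (full_words n) f g = 0" if "g \<in> subword_span n (k - 1)" for g
      using phi_orthogonal_subword_span[OF h(1) that] k2 h(2) fun_inner_commute[of _ f g] by simp
    ultimately show "f \<in> W_space n k" using V by (simp add: W_space_def)
  next
    assume f: "f \<in> W_space n k"
    then obtain u where u: "u \<in> fun_space (words_of_length n k)" "f = phi n u"
      using k2 by (auto simp: W_space_def V_space_def)
    obtain h where h: "h \<in> H_level n k" and d: "phi n u - phi n h \<in> subword_span n (k - 1)"
      by (rule phi_decomposition[OF k2(1) u(1)])
    define g where "g = phi n u - phi n h"
    have gd: "g \<in> subword_span n (k - 1)" using d by (simp add: g_def)
    have "fun_inner (full_words n) g f = 0"
      using f gd V fun_inner_commute[of _ g f] by (simp add: W_space_def)
    moreover have "fun_inner (full_words n) g (phi n h) = 0"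
      using phi_orthogonal_subword_span[OF h gd] k2 by simp
    ultimately have "fun_inner (full_words n) g g = 0"
      using fun_inner_diff_right[of "full_words n" g f "phi n h"] by (simp add: g_def u(2))
    then have "g v = 0" if "v \<in> full_words n" for v
      using fun_inner_self_eq_0[OF finite_full_words] that by blast
    moreover have "g \<in> fun_space (full_words n)"
      unfolding g_def by (intro subspace_diff subspace_fun_space phi_in_fun_space)
    ultimately have "g = 0" unfolding fun_space_def fun_eq_iff zero_fun_apply by blast
    then show "f \<in> phi n ` H_level n k" using h u(2) by (simp add: g_def)
  }
qed

lemma subword_span_subset_phi_image:
  assumes "1 \<le> n"
  shows "subword_span n k \<subseteq> phi n ` harmonic_space n"
proof (induction k)
  case 0
  have "[] \<in> words0 n" by (simp add: words0_def)
  have "dirac [] \<in> harmonic_space n"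
    unfolding harmonic_space_def harmonic_def
  proof (intro CollectI conjI allI impI)
    show "dirac [] \<in> fun_space (words0 n)" using \<open>[] \<in> words0 n\<close> by (auto simp: fun_space_def dirac_def)
    fix x w assume "distinct (x # w) \<and> set (x # w) \<subseteq> {1..n}"
    then show "insertion_sum x (dirac []) w = 0"
      by (auto simp: insertion_sum_eq dirac_def intro!: sum.neutral)
  qed
  then have "phi n (fact n *\<^sub>R dirac []) \<in> phi n ` harmonic_space n"
    by (intro imageI subspace_scale subspace_harmonic_space)
  moreover have "phi n (fact n *\<^sub>R dirac []) = indicator (full_words_over n [])"
    using \<open>[] \<in> words0 n\<close> by (simp add: linear_scale[OF linear_phi] phi_dirac)
  ultimately show ?case
    unfolding subword_span_def
    by (intro span_minimal linear_subspace_image linear_phi subspace_harmonic_space)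
      (auto simp: words_of_length_def)
next
  case (Suc k)
  show ?case
  proof (cases "k = 0")
    case True
    then show ?thesis using Suc subword_span_1[OF assms] by simp
  next
    case False
    show ?thesis
    proof
      fix f assume "f \<in> subword_span n (Suc k)"
      then obtain u where u: "u \<in> fun_space (words_of_length n (Suc k))" "f = phi n u"
        using V_space_eq[of "Suc k" n] False by (auto simp: V_space_def)
      obtain h where h: "h \<in> H_level n (Suc k)" "phi n u - phi n h \<in> subword_span n (Suc k - 1)"
        by (rule phi_decomposition[OF _ u(1)]) (use False in simp)
      then have "phi n u - phi n h \<in> phi n ` harmonic_space n" "phi n h \<in> phi n ` harmonic_space n"
        using Suc by (auto simp: H_level_eq)
      then have "(phi n u - phi n h) + phi n h \<in> phi n ` harmonic_space n"
        by (intro subspace_add linear_subspace_image linear_phi subspace_harmonic_space)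
      then show "f \<in> phi n ` harmonic_space n" using u(2) by simp
    qed
  qed
qed

lemma fun_space_full_words_subset: "fun_space (full_words n) \<subseteq> subword_span n n"
proof
  fix f assume f: "f \<in> fun_space (full_words n)"
  have "f = (\<Sum>w\<in>full_words n. f w *\<^sub>R indicator (full_words_over n w))"
  proof
    fix v
    have "full_words_over n w = {w}" if "w \<in> full_words n" for w
      using superwords_words_on[of w "{1..n}"] that by (simp add: full_words_over_def full_words_def)
    then have "(\<Sum>w\<in>full_words n. f w *\<^sub>R indicator (full_words_over n w)) v =
        (\<Sum>w\<in>full_words n. if w = v then f v else 0)"
      by (simp add: sum_fun_eval scaleR_fun_def indicator_def, intro sum.cong) auto
    then show "f v = (\<Sum>w\<in>full_words n. f w *\<^sub>R indicator (full_words_over n w)) v"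
      using f finite_full_words by (simp add: fun_space_def)
  qed
  moreover have "(\<Sum>w\<in>full_words n. f w *\<^sub>R indicator (full_words_over n w)) \<in> subword_span n n"
    unfolding subword_span_def full_words_eq by (intro span_sum span_scale span_base) blast
  ultimately show "f \<in> subword_span n n" by simp
qed

lemma phi_harmonic_eq_0:
  assumes f: "f \<in> harmonic_space n" and "phi n f = 0"
  shows "f = 0"
proof
  fix v
  have f': "f \<in> fun_space (words0 n)" "harmonic {1..n} f"
    using f by (simp_all add: harmonic_space_def)
  show "f v = 0 v"
  proof (cases "v \<in> words0 n")
    case True
    let ?g = "\<lambda>v. fact (length v) / fact n * f v"
    have "?g v = 0"
    proof (rule subword_sum_inj)
      show "harmonic {1..n} ?g" using harmonic_weight[OF f'(2), of "\<lambda>m. fact m / fact n"] by simp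
      show "subword_sum ?g w = 0" if "w \<in> words_on {1..n}" for w
        using phi_eq_subword_sum[OF f'(1), of w] that assms(2) by (simp add: full_words_def)
    qed (use True in \<open>simp_all add: words0_iff\<close>)
    then show ?thesis by simp
  qed (use f'(1) in \<open>simp add: fun_space_def\<close>)
qed

lemma bij_betw_phi:
  assumes "1 \<le> n"
  shows "bij_betw (phi n) (harmonic_space n) (fun_space (full_words n))"
  unfolding bij_betw_def
proof
  show "inj_on (phi n) (harmonic_space n)"
  proof (rule inj_onI)
    fix f g assume fg: "f \<in> harmonic_space n" "g \<in> harmonic_space n" "phi n f = phi n g"
    then have "f - g \<in> harmonic_space n" by (intro subspace_diff subspace_harmonic_space)
    moreover have "phi n (f - g) = 0" using fg(3) by (simp add: linear_diff[OF linear_phi])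
    ultimately have "f - g = 0" by (rule phi_harmonic_eq_0)
    then show "f = g" by simp
  qed
  show "phi n ` harmonic_space n = fun_space (full_words n)"
    using fun_space_full_words_subset[of n] subword_span_subset_phi_image[OF assms, of n]
      phi_in_fun_space by blast
qed

section \<open>Isomorphisms of representations\<close>

lemma linear_rep_subspace:
  assumes "linear_rep G V \<rho>" "subspace U" "U \<subseteq> V" "\<And>g. g \<in> carrier G \<Longrightarrow> \<rho> g ` U \<subseteq> U"
  shows "linear_rep G U \<rho>"
  using assms unfolding linear_rep_def linear_between_def by (meson subsetD)

lemma rep_iso_subspace:
  assumes iso: "rep_iso G V \<rho> W \<rho>' f" and U: "subspace U" "U \<subseteq> V"
    "\<And>g. g \<in> carrier G \<Longrightarrow> \<rho> g ` U \<subseteq> U" and fU: "subspace (f ` U)"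
  shows "rep_iso G U \<rho> (f ` U) \<rho>' f"
proof -
  have i: "linear_rep G V \<rho>" "linear_rep G W \<rho>'" "linear_between V W f" "bij_betw f V W"
    "\<And>g x. g \<in> carrier G \<Longrightarrow> x \<in> V \<Longrightarrow> f (\<rho> g x) = \<rho>' g (f x)"
    using iso by (simp_all add: rep_iso_def)
  have "linear_rep G U \<rho>" by (rule linear_rep_subspace[OF i(1) U])
  moreover have "linear_rep G (f ` U) \<rho>'"
  proof (rule linear_rep_subspace[OF i(2) fU])
    show "f ` U \<subseteq> W" using U(2) i(3) unfolding linear_between_def by blast
    fix g assume g: "g \<in> carrier G"
    show "\<rho>' g ` f ` U \<subseteq> f ` U"
    proof (intro image_subsetI, elim imageE)
      fix y x assume "y = f x" "x \<in> U"
      then have "\<rho>' g y = f (\<rho> g x)" "\<rho> g x \<in> U" using i(5)[OF g] U(2) U(3)[OF g] by auto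
      then show "\<rho>' g y \<in> f ` U" by simp
    qed
  qed
  moreover have "linear_between U (f ` U) f"
    using i(3) U(2) unfolding linear_between_def by (meson order_refl subsetD)
  moreover have "bij_betw f U (f ` U)"
    using i(4) U(2) by (meson bij_betw_def inj_on_subset)
  ultimately show ?thesis using i(5) U(2) unfolding rep_iso_def by blast
qed

lemma rep_iso_inverse:
  assumes iso: "rep_iso G V \<rho> W \<rho>' f"
  shows "rep_iso G W \<rho>' V \<rho> (the_inv_into V f)"
proof -
  have i: "linear_rep G V \<rho>" "linear_rep G W \<rho>'" "linear_between V W f" "bij_betw f V W"
    "\<And>g x. g \<in> carrier G \<Longrightarrow> x \<in> V \<Longrightarrow> f (\<rho> g x) = \<rho>' g (f x)"
    using iso by (simp_all add: rep_iso_def)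
  have V: "subspace V" "\<And>g x. g \<in> carrier G \<Longrightarrow> x \<in> V \<Longrightarrow> \<rho> g x \<in> V"
    using i(1) unfolding linear_rep_def linear_between_def by blast+
  have inj: "inj_on f V" and W: "f ` V = W" using i(4) by (simp_all add: bij_betw_def)
  let ?h = "the_inv_into V f"
  have h: "?h (f x) = x" if "x \<in> V" for x by (rule the_inv_into_f_f[OF inj that])
  have "linear_between W V ?h"
    unfolding linear_between_def W[symmetric]
  proof (intro conjI ballI allI)
    show "?h ` f ` V \<subseteq> V" using h by auto
    fix a assume "a \<in> f ` V"
    then obtain x where x: "x \<in> V" "a = f x" by blast
    {
      fix b assume "b \<in> f ` V"
      then obtain y where y: "y \<in> V" "b = f y" by blast
      have "f x + f y = f (x + y)" using i(3) x y unfolding linear_between_def by metis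
      then show "?h (a + b) = ?h a + ?h b" using x y V(1) by (simp add: h subspace_add)
    next
      fix c
      have "c *\<^sub>R f x = f (c *\<^sub>R x)" using i(3) x unfolding linear_between_def by metis
      then show "?h (c *\<^sub>R a) = c *\<^sub>R ?h a" using x V(1) by (simp add: h subspace_scale)
    }
  qed
  moreover have "?h (\<rho>' g a) = \<rho> g (?h a)" if g: "g \<in> carrier G" and "a \<in> W" for g a
  proof -
    obtain x where x: "x \<in> V" "a = f x" using \<open>a \<in> W\<close> W by blast
    then have "\<rho>' g a = f (\<rho> g x)" using i(5)[OF g] by simp
    then show ?thesis using h V(2)[OF g] x by simp
  qed
  ultimately show ?thesis
    using i(1,2) bij_betw_the_inv_into[OF i(4)] unfolding rep_iso_def by blast
qed

lemma words_permute:
  assumes "p permutes {1..n}"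
  shows "map p w \<in> words0 n \<longleftrightarrow> w \<in> words0 n"
    and "map p w \<in> full_words n \<longleftrightarrow> w \<in> full_words n"
    and "map p w \<in> words_of_length n k \<longleftrightarrow> w \<in> words_of_length n k"
proof -
  have inj: "inj p" by (rule permutes_inj[OF assms])
  then have d: "distinct (map p w) \<longleftrightarrow> distinct w"
    by (simp add: distinct_map inj_on_subset[OF inj])
  have img: "p ` {1..n} = {1..n}" by (rule permutes_image[OF assms])
  have s: "set (map p w) \<subseteq> {1..n} \<longleftrightarrow> set w \<subseteq> {1..n}"
    using inj_image_subset_iff[OF inj, of "set w" "{1..n}"] img by simp
  have e: "set (map p w) = {1..n} \<longleftrightarrow> set w = {1..n}"
    using inj_image_eq_iff[OF inj, of "set w" "{1..n}"] img by simp
  show "map p w \<in> words0 n \<longleftrightarrow> w \<in> words0 n" using d s by (simp only: words0_iff length_map)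
  show "map p w \<in> full_words n \<longleftrightarrow> w \<in> full_words n" using d e by (simp only: full_words_iff)
  show "map p w \<in> words_of_length n k \<longleftrightarrow> w \<in> words_of_length n k"
    using d s by (simp only: words_of_length_def mem_Collect_eq length_map)
qed

text \<open>
  The definition pushes point masses forward along \<open>p\<close>; on functions this is precomposition with the
  inverse of \<open>p\<close>.
\<close>

lemma act_eq:
  assumes "p permutes {1..n}" "f \<in> fun_space (words0 n)"
  shows "act n p f = (\<lambda>w. f (map (inv_into UNIV p) w))"
proof
  fix w
  let ?q = "inv_into UNIV p"
  have q: "?q permutes {1..n}" by (rule permutes_inv[OF assms(1)])
  have "map p (map ?q w) = w" "map ?q (map p v) = v" for v
    using permutes_inverses[OF assms(1)] by (simp_all add: comp_def map_idI)
  then have eq: "w = map p v \<longleftrightarrow> v = map ?q w" for v by metis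
  have "act n p f w = (\<Sum>v\<in>words0 n. if v = map ?q w then f (map ?q w) else 0)"
    unfolding act_def sum_fun_eval scaleR_fun_def dirac_def eq by (intro sum.cong) auto
  then show "act n p f w = f (map ?q w)"
    using finite_words0 assms(2) by (simp add: fun_space_def)
qed

lemma linear_rep_act: "linear_rep (sym_group n) (fun_space (words0 n)) (act n)"
  unfolding linear_rep_def linear_between_def
proof (intro conjI ballI allI)
  let ?L = "fun_space (words0 n)"
  show "Group.group (sym_group n)" by (rule sym_group_is_group)
  show sub: "subspace ?L" by (rule subspace_fun_space)
  show "act n \<one>\<^bsub>sym_group n\<^esub> f = f" if "f \<in> ?L" for f
    using act_eq[OF permutes_id that] by (simp add: sym_group_one inv_id)
  fix p assume "p \<in> carrier (sym_group n)"
  then have p: "p permutes {1..n}" by (simp add: sym_group_carrier)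
  have inv: "act n q f \<in> ?L" if q: "q permutes {1..n}" and f: "f \<in> ?L" for q f
    using f words_permute(1)[OF permutes_inv[OF q]] unfolding act_eq[OF q f] by (simp add: fun_space_def)
  show "act n p ` ?L \<subseteq> ?L" using inv[OF p] by blast
  show "act n p (f + g) = act n p f + act n p g" if "f \<in> ?L" "g \<in> ?L" for f g
    using that act_eq[OF p] subspace_add[OF sub] by (simp add: plus_fun_def)
  show "act n p (c *\<^sub>R f) = c *\<^sub>R act n p f" if "f \<in> ?L" for c f
    using that act_eq[OF p] subspace_scale[OF sub] by (simp add: scaleR_fun_def)
  fix q f assume "q \<in> carrier (sym_group n)" and f: "f \<in> ?L"
  then have q: "q permutes {1..n}" by (simp add: sym_group_carrier)
  have "inv_into UNIV (p \<circ> q) = inv_into UNIV q \<circ> inv_into UNIV p"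
    using p q by (intro o_inv_distrib permutes_bij)
  then show "act n (p \<otimes>\<^bsub>sym_group n\<^esub> q) f = act n p (act n q f)"
    using act_eq[OF permutes_compose[OF q p] f] act_eq[OF p inv[OF q f]] act_eq[OF q f]
    by (simp add: sym_group_mult comp_def)
qed

text \<open>
  Insertion sums are natural in the alphabet: renaming \<open>x\<close> and the letters of \<open>w\<close> renames all insertions,
  so harmonicity is preserved.
\<close>

lemma act_invariant:
  assumes "p permutes {1..n}"
  shows "X \<subseteq> words0 n \<Longrightarrow> (\<And>q w. q permutes {1..n} \<Longrightarrow> map q w \<in> X \<longleftrightarrow> w \<in> X) \<Longrightarrow>
      act n p ` fun_space X \<subseteq> fun_space X"
    and "act n p ` harmonic_space n \<subseteq> harmonic_space n"
proof -
  let ?q = "inv_into UNIV p"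
  have q: "?q permutes {1..n}" by (rule permutes_inv[OF assms])
  show 1: "act n p ` fun_space X \<subseteq> fun_space X"
    if X: "X \<subseteq> words0 n" "\<And>q w. q permutes {1..n} \<Longrightarrow> map q w \<in> X \<longleftrightarrow> w \<in> X" for X
  proof (intro image_subsetI)
    fix f assume f: "f \<in> fun_space X"
    then have "f \<in> fun_space (words0 n)" using X(1) by (auto simp: fun_space_def)
    then show "act n p f \<in> fun_space X"
      using f X(2)[OF q] by (simp add: act_eq[OF assms] fun_space_def)
  qed
  have ins: "insertion_sum x (\<lambda>v. f (map ?q v)) w = insertion_sum (?q x) f (map ?q w)" for x f w
    by (induction w arbitrary: f) simp_all
  show "act n p ` harmonic_space n \<subseteq> harmonic_space n"
  proof (intro image_subsetI)
    fix f assume "f \<in> harmonic_space n"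
    then have f: "f \<in> fun_space (words0 n)" "harmonic {1..n} f" by (simp_all add: harmonic_space_def)
    have "harmonic {1..n} (\<lambda>v. f (map ?q v))"
      unfolding harmonic_def
    proof (intro allI impI)
      fix x w assume "distinct (x # w) \<and> set (x # w) \<subseteq> {1..n}"
      then have "x # w \<in> words_of_length n (length (x # w))" by (simp add: words_of_length_def)
      then have "map ?q (x # w) \<in> words_of_length n (length (x # w))" by (simp only: words_permute[OF q])
      then have "distinct (?q x # map ?q w) \<and> set (?q x # map ?q w) \<subseteq> {1..n}"
        unfolding words_of_length_def by simp
      then show "insertion_sum x (\<lambda>v. f (map ?q v)) w = 0"
        unfolding ins using f(2) unfolding harmonic_def by blast
    qed
    moreover have "act n p f \<in> fun_space (words0 n)" using 1[of "words0 n"] words_permute(1) f(1) by blast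
    ultimately show "act n p f \<in> harmonic_space n"
      by (simp add: harmonic_space_def act_eq[OF assms f(1)])
  qed
qed

lemma phi_act:
  assumes p: "p permutes {1..n}" and f: "f \<in> fun_space (words0 n)" and n: "n \<noteq> 1"
  shows "phi n (act n p f) = act n p (phi n f)"
proof
  fix w
  let ?q = "inv_into UNIV p"
  have q: "?q permutes {1..n}" by (rule permutes_inv[OF p])
  have act: "act n p f \<in> fun_space (words0 n)"
    using act_invariant(1)[OF p, of "words0 n"] words_permute(1) f by blast
  have phi: "phi n f \<in> fun_space (words0 n)"
    using phi_in_fun_space[of n f] full_words_subset_words0[OF n] by (auto simp: fun_space_def)
  have map: "subword_sum (\<lambda>v. g (map ?q v)) w = subword_sum g (map ?q w)" for g :: "nat list \<Rightarrow> real"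
    by (induction w arbitrary: g) simp_all
  show "phi n (act n p f) w = act n p (phi n f) w"
  proof (cases "w \<in> full_words n")
    case True
    then have "map ?q w \<in> full_words n" by (simp only: words_permute[OF q])
    then show ?thesis
      using phi_eq_subword_sum[OF act True] phi_eq_subword_sum[OF f, of "map ?q w"]
        map[of "\<lambda>v. fact (length v) / fact n * f v"]
      by (simp add: act_eq[OF p] f phi)
  next
    case False
    then have "map ?q w \<notin> full_words n" by (simp add: words_permute(2)[OF q])
    then show ?thesis
      using False phi_in_fun_space[of n f] phi_in_fun_space[of n "act n p f"]
      by (simp add: act_eq[OF p phi] fun_space_def)
  qed
qed

lemma rep_iso_phi:
  assumes "2 \<le> n"
  shows "rep_iso (sym_group n) (harmonic_space n) (act n) (fun_space (full_words n)) (act n) (phi n)"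
  unfolding rep_iso_def
proof (intro conjI ballI)
  have full: "full_words n \<subseteq> words0 n" using assms by (intro full_words_subset_words0) simp
  show "linear_rep (sym_group n) (harmonic_space n) (act n)"
  proof (rule linear_rep_subspace[OF linear_rep_act subspace_harmonic_space])
    show "harmonic_space n \<subseteq> fun_space (words0 n)" by (auto simp: harmonic_space_def)
    show "act n p ` harmonic_space n \<subseteq> harmonic_space n" if "p \<in> carrier (sym_group n)" for p
      using that by (intro act_invariant(2)) (simp add: sym_group_carrier)
  qed
  show "linear_rep (sym_group n) (fun_space (full_words n)) (act n)"
  proof (rule linear_rep_subspace[OF linear_rep_act subspace_fun_space])
    show "fun_space (full_words n) \<subseteq> fun_space (words0 n)" using full by (auto simp: fun_space_def)
    show "act n p ` fun_space (full_words n) \<subseteq> fun_space (full_words n)"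
      if "p \<in> carrier (sym_group n)" for p
      using that by (intro act_invariant(1) full words_permute(2)) (simp_all add: sym_group_carrier)
  qed
  show "linear_between (harmonic_space n) (fun_space (full_words n)) (phi n)"
    using phi_in_fun_space[of n] linear_add[OF linear_phi] linear_scale[OF linear_phi]
    by (auto simp: linear_between_def)
  show "bij_betw (phi n) (harmonic_space n) (fun_space (full_words n))"
    using assms by (intro bij_betw_phi) simp
  show "phi n (act n p f) = act n p (phi n f)"
    if "p \<in> carrier (sym_group n)" "f \<in> harmonic_space n" for p f
    using that assms by (intro phi_act) (simp_all add: sym_group_carrier harmonic_space_def)
qed

lemma V_space_0_eq: "V_space n 0 = phi n ` H_level n 0"
proof -
  have "{B \<in> big_subsets0 {1..n}. card B = 0} = {{}}"
    by (auto simp: big_subsets0_def big_subsets_def)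
  then have "H_level n 0 = H_set n {}"
    by (auto simp: H_level_def sum_of_subspaces_def)
  then have "phi n ` H_level n 0 = span {phi n (dirac [])}"
    using linear_span_image[OF linear_phi, of n "{dirac []}"] by (simp add: H_set_def)
  also have "phi n (dirac []) = (1 / fact n) *\<^sub>R indicator (full_words n)"
    by (simp add: phi_dirac words0_def full_words_over_short)
  also have "span {(1 / fact n) *\<^sub>R indicator (full_words n)} = span {indicator (full_words n) :: nat list \<Rightarrow> real}"
    using span_image_scale[of "{indicator (full_words n) :: nat list \<Rightarrow> real}" "\<lambda>_. 1 / fact n"] by simp
  finally show ?thesis by (simp add: V_space_def)
qed

lemma rep_isomorphic_V_space_0:
  assumes "2 \<le> n"
  shows "rep_isomorphic (sym_group n) (V_space n 0) (act n) (UNIV :: real set) trivial_act"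
proof -
  let ?i = "indicator (full_words n) :: nat list \<Rightarrow> real"
  let ?f = "\<lambda>c. c *\<^sub>R ?i"
  have V: "V_space n 0 = range ?f" by (simp add: V_space_def span_singleton)
  have words: "?f c \<in> fun_space (words0 n)" for c
    using full_words_subset_words0[of n] assms by (auto simp: fun_space_def scaleR_fun_def indicator_def)
  have act: "act n p (?f c) = ?f c" if "p \<in> carrier (sym_group n)" for p c
  proof -
    have p: "p permutes {1..n}" using that by (simp add: sym_group_carrier)
    show ?thesis
      unfolding act_eq[OF p words] using words_permute(2)[OF permutes_inv[OF p]]
      by (simp add: scaleR_fun_def indicator_def)
  qed
  have "rep_iso (sym_group n) UNIV trivial_act (V_space n 0) (act n) ?f"
    unfolding rep_iso_def
  proof (intro conjI ballI)
    show "linear_rep (sym_group n) (UNIV :: real set) trivial_act"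
      by (simp add: linear_rep_def linear_between_def trivial_act_def sym_group_is_group)
    show "linear_rep (sym_group n) (V_space n 0) (act n)"
    proof (rule linear_rep_subspace[OF linear_rep_act])
      show "subspace (V_space n 0)" by (simp add: V_space_def)
      show "V_space n 0 \<subseteq> fun_space (words0 n)" unfolding V using words by (rule image_subsetI)
      show "act n p ` V_space n 0 \<subseteq> V_space n 0" if "p \<in> carrier (sym_group n)" for p
        using act[OF that] by (auto simp: V)
    qed
    show "linear_between UNIV (V_space n 0) ?f"
      by (auto simp: linear_between_def V scaleR_add_left)
    \<comment> \<open>Injectivity needs some full word, so that the indicator is not zero.\<close>
    have "[1..<Suc n] \<in> full_words n" by (auto simp: full_words_iff)
    then have "?i \<noteq> 0" by (metis indicator_eq_0_iff zero_fun_apply)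
    then show "bij_betw ?f UNIV (V_space n 0)"
      unfolding bij_betw_def V by (simp add: inj_on_def)
    show "?f (trivial_act p c) = act n p (?f c)" if "p \<in> carrier (sym_group n)" for p c
      using act[OF that] by (simp add: trivial_act_def)
  qed
  then show ?thesis unfolding rep_isomorphic_def by (blast dest: rep_iso_inverse)
qed

lemma rep_isomorphic_W_space:
  assumes n: "2 \<le> n" and k: "k \<in> {2..n}"
  shows "rep_isomorphic (sym_group n) (W_space n k) (act n) (H_level n k) (act n)"
proof -
  have sub: "subspace (H_level n k)"
    unfolding H_level_eq by (intro subspace_inter subspace_harmonic_space subspace_fun_space)
  have "rep_iso (sym_group n) (H_level n k) (act n) (phi n ` H_level n k) (act n) (phi n)"
  proof (rule rep_iso_subspace[OF rep_iso_phi[OF n] sub])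
    show "H_level n k \<subseteq> harmonic_space n" by (simp add: H_level_eq)
    show "subspace (phi n ` H_level n k)" by (rule linear_subspace_image[OF linear_phi sub])
    fix p assume "p \<in> carrier (sym_group n)"
    then have p: "p permutes {1..n}" by (simp add: sym_group_carrier)
    have "act n p ` fun_space (words_of_length n k) \<subseteq> fun_space (words_of_length n k)"
      using k by (intro act_invariant(1)[OF p] words_of_length_subset_words0 words_permute(3)) auto
    then show "act n p ` H_level n k \<subseteq> H_level n k"
      using act_invariant(2)[OF p] unfolding H_level_eq by blast
  qed
  then show ?thesis
    unfolding W_space_eq[OF k] rep_isomorphic_def by (blast dest: rep_iso_inverse)
qed

theorem theorem36:
  fixes n :: nat
  assumes "n \<ge> 2"
  shows "V_space n 0 = phi n ` H_level n 0 \<and>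
    (\<forall>k\<in>{2..n}. W_space n k = phi n ` H_level n k) \<and>
    rep_iso (sym_group n) (H_total n) (act n) (fun_space (full_words n)) (act n) (phi n) \<and>
    rep_isomorphic (sym_group n) (V_space n 0) (act n) (UNIV :: real set) trivial_act \<and>
    (\<forall>k\<in>{2..n}. rep_isomorphic (sym_group n) (W_space n k) (act n) (H_level n k) (act n))"
  unfolding H_total_eq
  by (intro conjI ballI V_space_0_eq W_space_eq rep_iso_phi rep_isomorphic_V_space_0
      rep_isomorphic_W_space assms)

end
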